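(* Let $G$ be a birth-death generator on $\mathcal X=\llbracket0,\mathfrak r\rrbracket$, reversible with respect to $\pi_G$, with birth rates $\mathtt b_x$ and death rates $\mathtt d_x$. Suppose that $G\stackrel{\Lambda_{pb}}{\sim}L$, i.e. $G\Lambda_{pb}=\Lambda_{pb}L$, and denote by $(P_t)_{t\ge0}$, $P_t=e^{tL}$, the transition semigroup associated with $L$ (which need not be Markov). For any $t\ge0$ and $j,x,y\in\llbracket0,\mathfrak r\rrbracket$, $P_t$ admits the spectral decomposition $$P_t(x,y)=\sum_{j=0}^{\mathfrak r}e^{-\lambda_jt}f_j(x)f_j^*(y)\pi_L(y),$$ where $$f_j^*(y)\pi_L(y)=\frac{\phi_j(y-1)\pi_G(y-1)}2\mathbf 1_{\{y-1\ge0\}}+\phi_j(y)\pi_G(y)\Big(\frac{\mathbf 1_{\{y\ne\mathfrak r\}}}2+\mathbf 1_{\{y=\mathfrak r\}}\Big),$$ $$f_j(x)=\sum_{k=x}^{\mathfrak r-1}(-2)^{k-x}\phi_j(k)+\phi_j(\mathfrak r),$$ and $$\|P_t-\pi_L\|_{TV}\le\frac{\kappa(\Lambda_{pb})e^{-\lambda_1t}}{2}\sqrt{\frac{1-\pi_L^*}{\pi_L^*}},$$ where $$\pi_L(y)=\pi_G(y-1)\frac{\mathbf 1_{\{y-1\ge0\}}}2+\pi_G(y)\Big(\frac{\mathbf 1_{\{y\ne\mathfrak r\}}}2+\mathbf 1_{\{y=\mathfrak r\}}\Big)\quad\text{and}\quad\pi_L^*=\min_{y\in\llbracket0,\mathfrak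 r\rrbracket}\pi_L(y).$$ Moreover, for all $x\in\llbracket0,\mathfrak r\rrbracket$, $$L(x,x)=-\mathtt b_x-\mathtt d_{\min\{x+1,\mathfrak r\}}\Big(\frac{\mathbf 1_{\{x+1\ge\mathfrak r\}}}2+\mathbf 1_{\{x+1<\mathfrak r\}}\Big)<0,$$ for $x>y+1$, $L(x,y)=0$, and for $x<\mathfrak r$, $$L(x+1,x)=\big(2\cdot\mathbf 1_{\{x+1\ne\mathfrak r\}}+\mathbf 1_{\{x+1=\mathfrak r\}}\big)\frac{\mathtt d_{x+1}}2>0.$$ If $\mathfrak r\ge4$, and for $y\in\llbracket1,\mathfrak r-1\rrbracket$, $$L(y-1,y)=-\mathtt d_{y-1}+\mathtt b_y+\mathtt d_{y+1}\mathbf 1_{\{y<\mathfrak r-1\}}+\frac{\mathtt d_{y+1}}2\mathbf 1_{\{y+1=\mathfrak r\}}\ge0\quad\text{and}\quad L(\mathfrak r-1,\mathfrak r)=-\mathtt d_{\mathfrak r-1}+\mathtt b_{\mathfrak r-1}+\mathtt d_{\mathfrak r}\ge0,$$ for $x\in\llbracket0,y-2\rrbracket$ and $y\in\llbracket2,\mathfrak r-1\rrbracket$, $$L(x,y)=(-1)^{x+y}\Big(\mathtt b_{y-2}+\mathtt d_{y-1}-\mathtt b_y-\mathtt d_{y+1}+\frac{\mathtt d_{\mathfrak r}}2\mathbf 1_{\{y=\mathfrak r-1\}}\Big)\ge0,$$ and for $x\in\llbracket0,\mathfrak r-2\rrbracket$, $$L(x,\mathfrak r)=(-1)^{x+\mathfrak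 r}\Big(\mathtt b_{\mathfrak r-2}+\mathtt d_{\mathfrak r-1}-\mathtt b_{\mathfrak r-1}-\frac{\mathtt d_{\mathfrak r}}2\Big)\ge0,$$ then $L$ is a Markov generator.
   Context: $\llbracket a,b\rrbracket=\{a,\dots,b\}$. $G(x,x-1)=\mathtt d_x$, $G(x,x)=-(\mathtt d_x+\mathtt b_x)$, $G(x,x+1)=\mathtt b_x$, all other entries zero, where $\mathtt d_x$ (resp. $\mathtt b_x$) is the death (resp. birth) rate at $x$ and $\mathtt d_0=\mathtt b_{\mathfrak r}=0$. $(-\lambda_j,\phi_j)_{j=0}^{\mathfrak r}$ are the eigenvalues and eigenvectors of $G$, with $0=\lambda_0\le\lambda_1\le\dots\le\lambda_{\mathfrak r}$ and $(\phi_j)$ orthonormal in $\ell^2(\pi_G)$, so that $e^{tG}(x,y)=\sum_{j=0}^{\mathfrak r}e^{-\lambda_jt}\phi_j(x)\phi_j(y)\pi_G(y)$. The pure birth link $\Lambda_{pb}$ is the matrix on $\llbracket0,\mathfrak r\rrbracket$ with $\Lambda_{pb}(x,y)=\frac12$ for $x\in\llbracket0,\mathfrak r-1\rrbracket$, $y\in\{x,x+1\}$, $\Lambda_{pb}(\mathfrak r,\mathfrak r)=1$, and all other entries $0$; it is invertible. $\kappa(\Lambda_{pb})=\|\Lambda_{pb}\|_{\ell^2(\pi_L)\to\ell^2(\pi_G)}\|\Lambda_{pb}^{-1}\|_{\ell^2(\pi_G)\to\ell^2(\pi_L)}$ is its condition number. $\|P_t-\pi_L\|_{TV}=\max_x\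frac12\sum_y|P_t(x,y)-\pi_L(y)|$.
   Formalization: f_j(x) is corrected to the sum over k from x to r-1 of 2(-1)^{k-x}φ_j(k), plus (-1)^{r-x}φ_j(r); L(r-1,r) is corrected to -d_{r-1}+b_{r-1}+d_r/2; r≥1 and strict positivity of all rates other than d_0 and b_r are assumed. *)

theory Defs
  imports Complex_Main
    "Jordan_Normal_Form.Char_Poly"
    "Jordan_Normal_Form.Gauss_Jordan_Elimination"
begin

text \<open>Matrices indexed by the state space \<open>{0, \<dots>, r}\<close> are \<open>(r + 1) \<times> (r + 1)\<close> matrices;
  measures on the state space and rates are functions on \<open>nat\<close>, used only on \<open>{..r}\<close>.\<close>

section \<open>Birth-death generators\<close>

text \<open>Strict positivity of the remaining rates is irreducibility of the chain.\<close>

definition birth_death_rates :: "nat \<Rightarrow> (nat \<Rightarrow> real) \<Rightarrow> (nat \<Rightarrow> real) \<Rightarrow> bool" where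
  "birth_death_rates r b d \<longleftrightarrow>
     d 0 = 0 \<and> b r = 0 \<and> (\<forall>x\<in>{1..r}. 0 < d x) \<and> (\<forall>x<r. 0 < b x)"

definition birth_death_generator ::
  "nat \<Rightarrow> (nat \<Rightarrow> real) \<Rightarrow> (nat \<Rightarrow> real) \<Rightarrow> real mat" where
  "birth_death_generator r b d = mat (r + 1) (r + 1) (\<lambda>(x, y).
     if x = y + 1 then d x
     else if x = y then - (d x + b x)
     else if y = x + 1 then b x
     else 0)"

definition prob_on :: "nat \<Rightarrow> (nat \<Rightarrow> real) \<Rightarrow> bool" where
  "prob_on r \<pi> \<longleftrightarrow> (\<forall>x\<le>r. 0 \<le> \<pi> x) \<and> (\<Sum>x\<le>r. \<pi> x) = 1"

definition reversible :: "nat \<Rightarrow> real mat \<Rightarrow> (nat \<Rightarrow> real) \<Rightarrow> bool" where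
  "reversible r A \<pi> \<longleftrightarrow> (\<forall>x\<le>r. \<forall>y\<le>r. \<pi> x * A $$ (x, y) = \<pi> y * A $$ (y, x))"

definition markov_generator :: "nat \<Rightarrow> real mat \<Rightarrow> bool" where
  "markov_generator r A \<longleftrightarrow> A \<in> carrier_mat (r + 1) (r + 1) \<and>
     (\<forall>x\<le>r. \<forall>y\<le>r. x \<noteq> y \<longrightarrow> 0 \<le> A $$ (x, y)) \<and>
     (\<forall>x\<le>r. (\<Sum>y\<le>r. A $$ (x, y)) = 0)"

definition mat_exp :: "real mat \<Rightarrow> real mat" where
  "mat_exp A = mat (dim_row A) (dim_row A)
     (\<lambda>(x, y). \<Sum>k. (A ^\<^sub>m k) $$ (x, y) / fact k)"

definition transition_semigroup :: "real mat \<Rightarrow> real \<Rightarrow> real mat" where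
  "transition_semigroup L t = mat_exp (t \<cdot>\<^sub>m L)"

section \<open>Weighted norms\<close>

definition l2_inner :: "(nat \<Rightarrow> real) \<Rightarrow> real vec \<Rightarrow> real vec \<Rightarrow> real" where
  "l2_inner \<pi> u v = (\<Sum>x<dim_vec u. u $ x * v $ x * \<pi> x)"

definition l2_norm :: "(nat \<Rightarrow> real) \<Rightarrow> real vec \<Rightarrow> real" where
  "l2_norm \<pi> v = sqrt (l2_inner \<pi> v v)"

text \<open>Operator norm of \<open>A\<close>, acting on column vectors, from \<open>\<ell>\<^sup>2(\<pi>)\<close> to \<open>\<ell>\<^sup>2(\<rho>)\<close>;
  the weights are meant to be strictly positive.\<close>

definition l2_opnorm :: "(nat \<Rightarrow> real) \<Rightarrow> (nat \<Rightarrow> real) \<Rightarrow> real mat \<Rightarrow> real" where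
  "l2_opnorm \<pi> \<rho> A =
     (SUP v \<in> carrier_vec (dim_col A) - {0\<^sub>v (dim_col A)}. l2_norm \<rho> (A *\<^sub>v v) / l2_norm \<pi> v)"

text \<open>Only used for invertible \<open>A\<close>, where \<open>mat_inverse A = Some B\<close> with \<open>B\<close> the two-sided
  inverse of \<open>A\<close>.\<close>

definition condition_number :: "(nat \<Rightarrow> real) \<Rightarrow> (nat \<Rightarrow> real) \<Rightarrow> real mat \<Rightarrow> real" where
  "condition_number \<pi> \<rho> A = l2_opnorm \<pi> \<rho> A * l2_opnorm \<rho> \<pi> (the (mat_inverse A))"

definition tv_dist :: "nat \<Rightarrow> real mat \<Rightarrow> (nat \<Rightarrow> real) \<Rightarrow> real" where
  "tv_dist r P \<pi> = (MAX x\<in>{..r}. 1 / 2 * (\<Sum>y\<le>r. \<bar>P $$ (x, y) - \<pi> y\<bar>))"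

section \<open>The pure birth link\<close>

definition pure_birth_link :: "nat \<Rightarrow> real mat" where
  "pure_birth_link r = mat (r + 1) (r + 1) (\<lambda>(x, y).
     if x < r \<and> (y = x \<or> y = x + 1) then 1 / 2
     else if x = r \<and> y = r then 1
     else 0)"

text \<open>In the next two definitions the indicator of \<open>1 \<le> y\<close> switches off the term in which
  the truncated subtraction \<open>y - 1\<close> would be wrong.\<close>

definition pb_measure :: "nat \<Rightarrow> (nat \<Rightarrow> real) \<Rightarrow> nat \<Rightarrow> real" where
  "pb_measure r \<pi>G y =
     \<pi>G (y - 1) * (of_bool (1 \<le> y) / 2) + \<pi>G y * (of_bool (y \<noteq> r) / 2 + of_bool (y = r))"

definition pb_dual :: "nat \<Rightarrow> (nat \<Rightarrow> real) \<Rightarrow> real vec \<Rightarrow> nat \<Rightarrow> real" where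
  "pb_dual r \<pi>G \<phi> y =
     (\<phi> $ (y - 1) * \<pi>G (y - 1) / 2 * of_bool (1 \<le> y)
      + \<phi> $ y * \<pi>G y * (of_bool (y \<noteq> r) / 2 + of_bool (y = r))) / pb_measure r \<pi>G y"

text \<open>The function \<open>f\<close> with \<open>pure_birth_link r *\<^sub>v f = \<phi>\<close>: one has \<open>f r = \<phi> $ r\<close> and
  \<open>f x = 2 * \<phi> $ x - f (x + 1)\<close> for \<open>x < r\<close>. Writing \<open>(- 2) ^ (k - x)\<close> for
  \<open>2 * (- 1) ^ (k - x)\<close> and dropping the sign of \<open>\<phi> $ r\<close> would not give a solution.\<close>

definition pb_lift :: "nat \<Rightarrow> real vec \<Rightarrow> nat \<Rightarrow> real" where
  "pb_lift r \<phi> x =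
     (\<Sum>k\<in>{x..<r}. 2 * (- 1) ^ (k - x) * \<phi> $ k) + (- 1) ^ (r - x) * \<phi> $ r"

end

theory Submission
  imports Defs
begin

text \<open>Write \<open>\<Lambda>\<close> for the pure birth link. As \<open>\<Lambda>\<close> is bidiagonal with non-zero diagonal, it is
  invertible, and the intertwining \<open>G \<Lambda> = \<Lambda> L\<close> says that \<open>L = \<Lambda>\<^sup>-\<^sup>1 G \<Lambda>\<close>. All the claims are
  read off from this conjugation.

  \<^bold>\<open>Entries of \<open>L\<close>.\<close> Row \<open>x < r\<close> of \<open>\<Lambda> L\<close> is the average of rows \<open>x\<close> and \<open>x + 1\<close> of \<open>L\<close>, and row \<open>r\<close>
  is row \<open>r\<close> of \<open>L\<close>. So \<open>L(x, y) = 2 (G \<Lambda>)(x, y) - L(x + 1, y)\<close>, which determines each column from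
  the bottom up (\<open>L_last_row\<close>, \<open>L_step\<close>). The matrix \<open>G \<Lambda>\<close> is banded, so column \<open>y\<close> vanishes
  below row \<open>y + 1\<close> and only changes sign from one row to the next above row \<open>y - 2\<close>. This
  alternation is what makes nonnegativity so restrictive: two consecutive entries that
  are both nonnegative vanish.

  \<^bold>\<open>Spectral decomposition.\<close> If \<open>\<phi>\<close> is an eigenvector of \<open>G\<close>, then \<open>f = \<Lambda>\<^sup>-\<^sup>1 \<phi>\<close> is one of \<open>L\<close>, for the
  same eigenvalue; solving \<open>\<Lambda> f = \<phi>\<close> from the bottom up gives the alternating sum \<open>pb_lift\<close>.
  The row vectors \<open>(\<phi> \<pi>\<^sub>G) \<Lambda>\<close> are biorthogonal to these functions, because
  \<open>\<Sum>\<^sub>j \<phi>\<^sub>j (\<phi>\<^sub>j \<pi>\<^sub>G)\<close> is the identity matrix and conjugation by \<open>\<Lambda>\<close> preserves it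
  (\<open>lift_dual_resolution\<close>). Every power of \<open>L\<close>, and therefore its exponential, is then diagonal
  in this system (\<open>mat_exp_spectral\<close>).

  \<^bold>\<open>Total variation.\<close> Let \<open>g\<close> be the sign of \<open>P\<^sub>t(x, \<cdot>) - \<pi>\<^sub>L\<close>. Twice the total variation distance at
  \<open>x\<close> is \<open>u x\<close> for \<open>u = P\<^sub>t g - \<pi>\<^sub>L g = \<Lambda>\<^sup>-\<^sup>1 (e\<^sup>t\<^sup>G - \<pi>\<^sub>G) \<Lambda> g\<close>. Irreducibility makes \<open>\<phi>\<^sub>0\<close> constant, so
  \<open>e\<^sup>t\<^sup>G - \<pi>\<^sub>G\<close> is the part of the expansion with \<open>j \<ge> 1\<close> and has norm at most \<open>exp (- \<lambda>\<^sub>1 t)\<close>; the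
  two links contribute the condition number, and \<open>g\<close> has norm at most one. Finally \<open>u\<close> has
  mean zero under \<open>\<pi>\<^sub>L\<close>, and for such functions evaluation at \<open>x\<close> has norm
  \<open>sqrt ((1 - \<pi>\<^sub>L x) / \<pi>\<^sub>L x)\<close> (\<open>point_evaluation_bound\<close>).\<close>

section \<open>Matrices acting on functions\<close>

lemma mult_entry:
  assumes "A \<in> carrier_mat (r + 1) (r + 1)" "B \<in> carrier_mat (r + 1) (r + 1)" "x \<le> r" "y \<le> r"
  shows "(A * B) $$ (x, y) = (\<Sum>k\<le>r. A $$ (x, k) * B $$ (k, y))"
  using assms by (auto simp: scalar_prod_def atLeast0LessThan lessThan_Suc_atMost intro!: sum.cong)

lemma mult_vec_entry:
  assumes "A \<in> carrier_mat (r + 1) (r + 1)" "v \<in> carrier_vec (r + 1)" "x \<le> r"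
  shows "(A *\<^sub>v v) $ x = (\<Sum>k\<le>r. A $$ (x, k) * v $ k)"
  using assms by (auto simp: scalar_prod_def atLeast0LessThan lessThan_Suc_atMost intro!: sum.cong)

lemma l2_inner_eq:
  assumes "u \<in> carrier_vec (r + 1)"
  shows "l2_inner \<pi> u v = (\<Sum>x\<le>r. u $ x * v $ x * \<pi> x)"
  using assms by (auto simp: l2_inner_def lessThan_Suc_atMost intro!: sum.cong)

section \<open>The pure birth link\<close>

lemma pure_birth_link_carrier: "pure_birth_link r \<in> carrier_mat (r + 1) (r + 1)"
  by (simp add: pure_birth_link_def)

lemma pure_birth_link_apply:
  assumes "x \<le> r"
  shows "(\<Sum>y\<le>r. pure_birth_link r $$ (x, y) * g y) = (if x < r then (g x + g (x + 1)) / 2 else g r)"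
proof (cases "x < r")
  case True
  have "(\<Sum>y\<le>r. pure_birth_link r $$ (x, y) * g y)
      = (\<Sum>y\<le>r. (if y = x then g y / 2 else 0) + (if y = x + 1 then g y / 2 else 0))"
    using True by (intro sum.cong) (auto simp: pure_birth_link_def)
  also have "\<dots> = (g x + g (x + 1)) / 2"
    using True by (simp add: sum.distrib add_divide_distrib)
  finally show ?thesis using True by simp
next
  case False
  then have "x = r" using assms by simp
  then have "(\<Sum>y\<le>r. pure_birth_link r $$ (x, y) * g y) = (\<Sum>y\<le>r. if y = r then g y else 0)"
    by (intro sum.cong) (auto simp: pure_birth_link_def)
  then show ?thesis using False by simp
qed

lemma pure_birth_link_push_forward:
  assumes "y \<le> r"
  shows "(\<Sum>x\<le>r. p x * pure_birth_link r $$ (x, y))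
    = p (y - 1) / 2 * of_bool (1 \<le> y) + p y * (of_bool (y \<noteq> r) / 2 + of_bool (y = r))"
proof -
  have "(\<Sum>x\<le>r. p x * pure_birth_link r $$ (x, y))
      = (\<Sum>x\<le>r. (if x = y - 1 then p x / 2 * of_bool (1 \<le> y) else 0)
          + (if x = y then p x * (of_bool (y \<noteq> r) / 2 + of_bool (y = r)) else 0))"
    using assms by (intro sum.cong) (auto simp: pure_birth_link_def)
  moreover have "y - 1 \<le> r" using assms by simp
  ultimately show ?thesis using assms by (simp add: sum.distrib)
qed

lemma pb_measure_eq:
  assumes "y \<le> r"
  shows "pb_measure r p y = (\<Sum>x\<le>r. p x * pure_birth_link r $$ (x, y))"
  using pure_birth_link_push_forward[OF assms, of p] by (simp add: pb_measure_def)

text \<open>At the last state the link returns the value of a function, and at an earlier state its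
  average with the next value, so the values are recovered from \<open>r\<close> downwards. This is the form
  in which the invertibility of the link is used for functions.\<close>

lemma pure_birth_link_inject:
  assumes "\<And>x. x \<le> r \<Longrightarrow> (\<Sum>y\<le>r. pure_birth_link r $$ (x, y) * u y)
      = (\<Sum>y\<le>r. pure_birth_link r $$ (x, y) * v y)"
    and "x \<le> r"
  shows "u x = v x"
  using assms(2)
proof (induction rule: inc_induct)
  case base
  show ?case using assms(1)[of r] by (simp add: pure_birth_link_apply)
next
  case (step x)
  then show ?case using assms(1)[of x] by (simp add: pure_birth_link_apply)
qed

text \<open>Consecutive alternating sums cancel except for their leading term:
  \<open>pb_lift r \<phi> x + pb_lift r \<phi> (x + 1) = 2 * \<phi> $ x\<close>.\<close>

lemma pb_lift_solves:
  assumes "x \<le> r"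
  shows "(\<Sum>y\<le>r. pure_birth_link r $$ (x, y) * pb_lift r \<phi> y) = \<phi> $ x"
proof (cases "x < r")
  case True
  have "(\<Sum>k\<in>{x + 1..<r}. 2 * (- 1) ^ (k - x) * \<phi> $ k)
      = - (\<Sum>k\<in>{x + 1..<r}. 2 * (- 1) ^ (k - (x + 1)) * \<phi> $ k)"
    unfolding sum_negf[symmetric]
  proof (rule sum.cong[OF refl])
    fix k assume "k \<in> {x + 1..<r}"
    then have "k - x = Suc (k - (x + 1))" by auto
    then show "2 * (- 1) ^ (k - x) * \<phi> $ k = - (2 * (- 1) ^ (k - (x + 1)) * \<phi> $ k)" by simp
  qed
  moreover have "(- 1 :: real) ^ (r - x) = - ((- 1) ^ (r - (x + 1)))"
    using True by (metis Suc_diff_Suc Suc_eq_plus1 mult_minus1 power_Suc)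
  ultimately have "pb_lift r \<phi> x + pb_lift r \<phi> (x + 1) = 2 * \<phi> $ x"
    using True by (simp add: pb_lift_def sum.atLeast_Suc_lessThan)
  then show ?thesis using True by (simp add: pure_birth_link_apply)
next
  case False
  then show ?thesis using assms by (simp add: pure_birth_link_apply pb_lift_def)
qed

text \<open>The lifts of the unit vectors are the columns of a right inverse, which for a square matrix
  is two-sided; it shows that the elimination defining \<open>mat_inverse\<close> succeeds.\<close>

lemma pure_birth_link_inverse:
  obtains B where "mat_inverse (pure_birth_link r) = Some B" "B \<in> carrier_mat (r + 1) (r + 1)"
    "pure_birth_link r * B = 1\<^sub>m (r + 1)" "B * pure_birth_link r = 1\<^sub>m (r + 1)"
proof -
  let ?L = "pure_birth_link r"
  define C where "C = mat (r + 1) (r + 1) (\<lambda>(x, y). pb_lift r (unit_vec (r + 1) y) x)"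
  have C: "C \<in> carrier_mat (r + 1) (r + 1)" by (simp add: C_def)
  have LC: "?L * C = 1\<^sub>m (r + 1)"
  proof (rule eq_matI)
    fix x y assume "x < dim_row (1\<^sub>m (r + 1) :: real mat)" "y < dim_col (1\<^sub>m (r + 1) :: real mat)"
    then have xy: "x \<le> r" "y \<le> r" by auto
    have "(?L * C) $$ (x, y) = (\<Sum>k\<le>r. ?L $$ (x, k) * C $$ (k, y))"
      by (rule mult_entry[OF pure_birth_link_carrier C xy])
    also have "\<dots> = (\<Sum>k\<le>r. ?L $$ (x, k) * pb_lift r (unit_vec (r + 1) y) k)"
      using xy by (intro sum.cong) (auto simp: C_def)
    also have "\<dots> = 1\<^sub>m (r + 1) $$ (x, y)"
      using xy by (simp add: pb_lift_solves unit_vec_def)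
    finally show "(?L * C) $$ (x, y) = 1\<^sub>m (r + 1) $$ (x, y)" .
  qed (auto simp: C_def pure_birth_link_def)
  have CL: "C * ?L = 1\<^sub>m (r + 1)"
    by (rule mat_mult_left_right_inverse[OF pure_birth_link_carrier C LC])
  have "?L \<in> Units (ring_mat TYPE(real) (r + 1) ())"
    using C LC CL pure_birth_link_carrier[of r] by (auto simp: Units_def ring_mat_def)
  then obtain B where "mat_inverse ?L = Some B"
    using mat_inverse(1)[OF pure_birth_link_carrier, of r "()"] by fastforce
  then show thesis using mat_inverse(2)[OF pure_birth_link_carrier] that by blast
qed

section \<open>Birth-death generators\<close>

lemma birth_death_generator_carrier: "birth_death_generator r b d \<in> carrier_mat (r + 1) (r + 1)"
  by (simp add: birth_death_generator_def)

text \<open>Because \<open>d 0 = 0\<close> and \<open>b r = 0\<close>, the meaningless values of \<open>h\<close> at \<open>0 - 1\<close> and at \<open>r + 1\<close> are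
  multiplied by zero, and one formula covers the boundary states too.\<close>

lemma birth_death_generator_apply:
  assumes "d 0 = 0" "b r = 0" "x \<le> r"
  shows "(\<Sum>y\<le>r. birth_death_generator r b d $$ (x, y) * h y)
    = d x * (h (x - 1) - h x) + b x * (h (x + 1) - h x)"
proof -
  have "(\<Sum>y\<le>r. birth_death_generator r b d $$ (x, y) * h y)
      = (\<Sum>y\<le>r. (if y = x - 1 then d x * h y else 0) + (if y = x then - (d x + b x) * h y else 0)
          + (if y = x + 1 then b x * h y else 0))"
    using assms by (intro sum.cong) (auto simp: birth_death_generator_def)
  also have "\<dots> = d x * h (x - 1) - (d x + b x) * h x + b x * h (x + 1)"
    using assms by (cases "x = r") (auto simp: sum.distrib algebra_simps)
  finally show ?thesis by (simp add: algebra_simps)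
qed

text \<open>Harmonicity at \<open>x\<close> reads \<open>b x * (h (x + 1) - h x) = d x * (h x - h (x - 1))\<close>, so the increments
  of \<open>h\<close> vanish one after the other, from the left boundary on, where \<open>d 0 = 0\<close>.\<close>

lemma birth_death_harmonic_const:
  assumes rates: "birth_death_rates r b d"
    and harmonic: "\<And>x. x \<le> r \<Longrightarrow> (\<Sum>y\<le>r. birth_death_generator r b d $$ (x, y) * h y) = 0"
    and "x \<le> r"
  shows "h x = h 0"
proof -
  have 0: "d 0 = 0" "b r = 0" and b: "\<And>x. x < r \<Longrightarrow> b x > 0"
    using rates by (auto simp: birth_death_rates_def)
  have "x < r \<Longrightarrow> h (x + 1) = h x" for x
  proof (induction x)
    case 0
    then show ?case using harmonic[of 0] b[of 0]
        birth_death_generator_apply[of d b r 0 h] \<open>d 0 = 0\<close> \<open>b r = 0\<close> by simp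
  next
    case (Suc x)
    then show ?case using harmonic[of "Suc x"] b[of "Suc x"]
        birth_death_generator_apply[of d b r "Suc x" h] \<open>d 0 = 0\<close> \<open>b r = 0\<close> by simp
  qed
  then show ?thesis using \<open>x \<le> r\<close> by (induction x) auto
qed

text \<open>Detailed balance between neighbours, with positive rates, propagates both vanishing and
  positivity from state \<open>0\<close> to all states; vanishing is excluded by the total mass.\<close>

lemma reversible_measure_pos:
  assumes rates: "birth_death_rates r b d" and prob: "prob_on r \<pi>"
    and rev: "reversible r (birth_death_generator r b d) \<pi>" and "x \<le> r"
  shows "0 < \<pi> x"
proof -
  have b: "0 < b x" if "x < r" for x using that rates by (auto simp: birth_death_rates_def)
  have d: "0 < d (x + 1)" if "x < r" for x using that rates by (auto simp: birth_death_rates_def)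
  have nonneg: "0 \<le> \<pi> x" if "x \<le> r" for x using prob that by (auto simp: prob_on_def)
  have balance: "\<pi> x * b x = \<pi> (x + 1) * d (x + 1)" if "x < r" for x
    using rev[unfolded reversible_def, rule_format, of x "x + 1"] that
    by (simp add: birth_death_generator_def)
  have "\<pi> 0 \<noteq> 0"
  proof
    assume "\<pi> 0 = 0"
    then have "x \<le> r \<Longrightarrow> \<pi> x = 0" for x
    proof (induction x)
      case (Suc x)
      then show ?case using balance[of x] d[of x] by simp
    qed
    then show False using prob by (simp add: prob_on_def)
  qed
  then have "0 < \<pi> 0" using nonneg[of 0] by simp
  with \<open>x \<le> r\<close> show ?thesis
  proof (induction x)
    case (Suc x)
    then have "0 < \<pi> x * b x" using b[of x] by simp
    then have "0 < \<pi> (x + 1) * d (x + 1)" using balance[of x] Suc.prems by simp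
    then show ?case using d[of x] Suc.prems by (simp add: zero_less_mult_iff)
  qed
qed

text \<open>The link is a stochastic matrix, so it preserves total mass.\<close>

lemma pb_measure_prob:
  assumes "prob_on r p"
  shows "prob_on r (pb_measure r p)"
proof -
  have "(\<Sum>y\<le>r. pb_measure r p y) = (\<Sum>y\<le>r. \<Sum>x\<le>r. p x * pure_birth_link r $$ (x, y))"
    by (simp add: pb_measure_eq)
  also have "\<dots> = (\<Sum>x\<le>r. \<Sum>y\<le>r. p x * pure_birth_link r $$ (x, y))" by (rule sum.swap)
  also have "\<dots> = (\<Sum>x\<le>r. p x * (\<Sum>y\<le>r. pure_birth_link r $$ (x, y) * 1))"
    by (simp add: sum_distrib_left)
  also have "\<dots> = (\<Sum>x\<le>r. p x)"
    unfolding pure_birth_link_apply[where g = "\<lambda>_. 1"]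
    by (intro sum.cong refl) (simp only: atMost_iff pure_birth_link_apply, simp)
  also have "\<dots> = 1" using assms by (simp add: prob_on_def)
  finally show ?thesis using assms by (auto simp: prob_on_def pb_measure_def)
qed

lemma pb_measure_pos:
  assumes "\<And>x. x \<le> r \<Longrightarrow> 0 < p x" "y \<le> r"
  shows "0 < pb_measure r p y"
  using assms(1)[of y] assms(1)[of "y - 1"] assms(2)
  by (auto simp: pb_measure_def add_pos_nonneg)

section \<open>The entries of the intertwined matrix\<close>

locale pure_birth_intertwining =
  fixes r :: nat and b d :: "nat \<Rightarrow> real" and L :: "real mat"
  assumes r: "1 \<le> r"
    and rates: "birth_death_rates r b d"
    and L_dim: "L \<in> carrier_mat (r + 1) (r + 1)"
    and link: "birth_death_generator r b d * pure_birth_link r = pure_birth_link r * L"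
begin

lemma b_r: "b r = 0" and d_0: "d 0 = 0"
  and b_pos: "x < r \<Longrightarrow> 0 < b x" and d_pos: "1 \<le> x \<Longrightarrow> x \<le> r \<Longrightarrow> 0 < d x"
  using rates by (auto simp: birth_death_rates_def)

text \<open>The intertwining as an identity between operators on functions.\<close>

lemma link_apply:
  assumes "x \<le> r"
  shows "(\<Sum>k\<le>r. pure_birth_link r $$ (x, k) * (\<Sum>y\<le>r. L $$ (k, y) * h y))
    = (\<Sum>k\<le>r. birth_death_generator r b d $$ (x, k) * (\<Sum>y\<le>r. pure_birth_link r $$ (k, y) * h y))"
proof -
  have "(\<Sum>k\<le>r. A $$ (x, k) * (\<Sum>y\<le>r. B $$ (k, y) * h y)) = (\<Sum>y\<le>r. (A * B) $$ (x, y) * h y)"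
    if "A \<in> carrier_mat (r + 1) (r + 1)" "B \<in> carrier_mat (r + 1) (r + 1)" for A B :: "real mat"
  proof -
    have "(\<Sum>k\<le>r. A $$ (x, k) * (\<Sum>y\<le>r. B $$ (k, y) * h y))
        = (\<Sum>k\<le>r. \<Sum>y\<le>r. A $$ (x, k) * B $$ (k, y) * h y)"
      by (simp add: sum_distrib_left mult.assoc)
    also have "\<dots> = (\<Sum>y\<le>r. \<Sum>k\<le>r. A $$ (x, k) * B $$ (k, y) * h y)" by (rule sum.swap)
    also have "\<dots> = (\<Sum>y\<le>r. (A * B) $$ (x, y) * h y)"
      using that assms by (simp add: mult_entry sum_distrib_right del: index_mult_mat)
    finally show ?thesis .
  qed
  from this[OF pure_birth_link_carrier L_dim]
    this[OF birth_death_generator_carrier pure_birth_link_carrier]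
  show ?thesis by (simp only: link)
qed

lemma L_entry:
  assumes "x \<le> r" "y \<le> r"
  shows "(\<Sum>k\<le>r. pure_birth_link r $$ (x, k) * L $$ (k, y))
    = d x * (pure_birth_link r $$ (x - 1, y) - pure_birth_link r $$ (x, y))
      + b x * (pure_birth_link r $$ (x + 1, y) - pure_birth_link r $$ (x, y))"
proof -
  have "(\<Sum>k\<le>r. pure_birth_link r $$ (x, k) * L $$ (k, y))
      = (\<Sum>k\<le>r. birth_death_generator r b d $$ (x, k) * pure_birth_link r $$ (k, y))"
    unfolding mult_entry[OF pure_birth_link_carrier L_dim assms, symmetric]
      mult_entry[OF birth_death_generator_carrier pure_birth_link_carrier assms, symmetric]
    by (simp only: link)
  then show ?thesis
    using birth_death_generator_apply[where h = "\<lambda>k. pure_birth_link r $$ (k, y)",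
        of d b r x] assms d_0 b_r by simp
qed

lemma L_last_row:
  assumes "y \<le> r"
  shows "L $$ (r, y) = d r / 2 * (of_bool (y + 1 = r) - of_bool (y = r))"
  using L_entry[of r y] assms b_r r pure_birth_link_apply[of r r "\<lambda>k. L $$ (k, y)"]
  by (auto simp: pure_birth_link_def split: if_splits)

text \<open>The equation that gives row \<open>x\<close> of \<open>L\<close> from row \<open>x + 1\<close>. The terms with the rates are twice the entry
  \<open>(x, y)\<close> of \<open>G \<Lambda>\<close>. The last state, where the link has the entry \<open>1\<close> instead of \<open>1 / 2\<close>, gives rise
  to the case \<open>y = x + 1 = r\<close>.\<close>

lemma L_step:
  assumes "x < r" "y \<le> r"
  shows "L $$ (x, y) =
    d x * (of_bool (y + 1 = x) - of_bool (y = x + 1))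
    + b x * (of_bool (y = x + 1 \<and> y = r) + of_bool (y = x + 2) - of_bool (y = x))
    - L $$ (x + 1, y)"
proof -
  consider "x = 0" | "0 < x" by auto
  then show ?thesis
    by cases (use L_entry[of x y] assms d_0 pure_birth_link_apply[of x r "\<lambda>k. L $$ (k, y)"] in
      \<open>auto simp: pure_birth_link_def of_bool_def field_simps split: if_splits\<close>)
qed

lemma L_below:
  assumes "x \<le> r" "y + 1 < x"
  shows "L $$ (x, y) = 0"
  using assms
proof (induction rule: inc_induct)
  case base
  then show ?case by (simp add: L_last_row)
next
  case (step x)
  then show ?case by (simp add: L_step)
qed

lemma L_sub:
  assumes "x < r"
  shows "L $$ (x + 1, x) = (2 * of_bool (x + 1 \<noteq> r) + of_bool (x + 1 = r)) * (d (x + 1) / 2)"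
  using assms L_step[of "x + 1" x] L_below[of "x + 2" x]
  by (cases "x + 1 = r") (auto simp: L_last_row)

lemma L_sub_pos:
  assumes "x < r"
  shows "0 < L $$ (x + 1, x)"
proof -
  have "0 < d (x + 1)" using assms by (intro d_pos) auto
  then show ?thesis using L_sub[OF assms] by (cases "x + 1 = r") simp_all
qed

lemma L_diag:
  assumes "x \<le> r"
  shows "L $$ (x, x) =
    - b x - d (min (x + 1) r) * (of_bool (r \<le> x + 1) / 2 + of_bool (x + 1 < r))"
proof (cases "x = r")
  case True
  then show ?thesis using L_last_row[of r] r by (simp add: b_r)
next
  case False
  then show ?thesis using assms L_step[of x x] L_sub[of x] by (auto simp: min_def)
qed

lemma L_super:
  assumes "x < r"
  shows "L $$ (x, x + 1) = b x * of_bool (x + 1 = r) - d x - L $$ (x + 1, x + 1)"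
  using assms L_step[of x "x + 1"] by simp

text \<open>Only \<open>b (y - 2)\<close> enters the recursion at row \<open>y - 2\<close>, and no rate at the rows above it, where
  the sign just alternates.\<close>

lemma L_above:
  assumes "x + 2 \<le> y" "y \<le> r"
  shows "L $$ (x, y) = (- 1) ^ (x + y) * (b (y - 2) - L $$ (y - 1, y))"
proof -
  have "x \<le> y - 2" using assms by simp
  then show ?thesis
  proof (induction rule: inc_induct)
    case base
    obtain k where "y = k + 2"
      using assms by (metis add.commute le_Suc_ex trans_le_add2 le_add2 add_leE)
    then show ?case using assms L_step[of k y] by simp
  next
    case (step x)
    have "x < r" "y \<noteq> x + 1" "y \<noteq> x + 2" "y \<noteq> x" "y + 1 \<noteq> x" using step.hyps assms by auto
    then have "L $$ (x, y) = - L $$ (x + 1, y)" using assms L_step[of x y] by simp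
    then show ?case using step.IH by simp
  qed
qed

lemma L_diag_neg:
  assumes "x \<le> r"
  shows "L $$ (x, x) < 0"
proof -
  have "0 \<le> b x" using b_pos[of x] b_r assms by (cases "x = r") auto
  moreover have "0 < d (min (x + 1) r)" using r by (intro d_pos) auto
  ultimately show ?thesis using r assms by (cases "x + 1 < r") (auto simp: L_diag min_def)
qed

text \<open>\<open>G\<close> annihilates constants and the link preserves them, so the link maps \<open>L\<close> applied to \<open>1\<close>
  to \<open>0\<close>.\<close>

lemma L_row_sum:
  assumes "x \<le> r"
  shows "(\<Sum>y\<le>r. L $$ (x, y)) = 0"
proof -
  have "(\<Sum>k\<le>r. pure_birth_link r $$ (x, k) * (\<Sum>y\<le>r. L $$ (k, y) * 1)) = 0" if "x \<le> r" for x
  proof -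
    have "(\<Sum>k\<le>r. birth_death_generator r b d $$ (x, k) * (\<Sum>y\<le>r. pure_birth_link r $$ (k, y) * 1))
        = (\<Sum>k\<le>r. birth_death_generator r b d $$ (x, k) * 1)"
      by (intro sum.cong refl) (simp only: atMost_iff pure_birth_link_apply, simp)
    also have "\<dots> = 0" using that by (simp only: birth_death_generator_apply d_0 b_r) simp
    finally show ?thesis using link_apply[OF that, of "\<lambda>_. 1"] by simp
  qed
  then have "(\<Sum>k\<le>r. pure_birth_link r $$ (x, k) * (\<Sum>y\<le>r. L $$ (k, y)))
      = (\<Sum>k\<le>r. pure_birth_link r $$ (x, k) * 0)" if "x \<le> r" for x
    using that by simp
  then show ?thesis by (rule pure_birth_link_inject) (use assms in auto)
qed

lemma L_superdiag_interior:
  assumes "y \<in> {1..r - 1}"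
  shows "L $$ (y - 1, y) =
    - d (y - 1) + b y + d (y + 1) * of_bool (y < r - 1) + d (y + 1) / 2 * of_bool (y + 1 = r)"
proof -
  obtain x where "y = x + 1"
    using assms by (metis Suc_eq_plus1 Suc_le_D One_nat_def atLeastAtMost_iff)
  then show ?thesis using assms L_super[of x] L_diag[of y] by (auto simp: min_def)
qed

lemma L_superdiag_last: "L $$ (r - 1, r) = - d (r - 1) + b (r - 1) + d r / 2"
  using r L_super[of "r - 1"] L_diag[of r] b_r by simp

lemma L_above_interior:
  assumes "y \<in> {2..r - 1}" "x \<in> {0..y - 2}"
  shows "L $$ (x, y) =
    (- 1) ^ (x + y) * (b (y - 2) + d (y - 1) - b y - d (y + 1) + d r / 2 * of_bool (y = r - 1))"
proof -
  have "x + 2 \<le> y" "y \<le> r" "y \<in> {1..r - 1}" using assms by auto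
  then have "y - 1 \<le> r" "L $$ (x, y) = (- 1) ^ (x + y) * (b (y - 2) - L $$ (y - 1, y))"
    by (simp_all add: L_above)
  moreover have "L $$ (y - 1, y) =
      - d (y - 1) + b y + d (y + 1) - d r / 2 * of_bool (y = r - 1)"
  proof (cases "y = r - 1")
    case True
    then have "y + 1 = r" using r by simp
    then show ?thesis using L_superdiag_interior[OF \<open>y \<in> {1..r - 1}\<close>] True by simp
  next
    case False
    then have "y < r - 1" "y + 1 \<noteq> r" using assms by auto
    then show ?thesis using L_superdiag_interior[OF \<open>y \<in> {1..r - 1}\<close>] by simp
  qed
  ultimately have "L $$ (x, y) = (- 1) ^ (x + y) * (b (y - 2) - L $$ (y - 1, y))"
    and "b (y - 2) - L $$ (y - 1, y)
      = b (y - 2) + d (y - 1) - b y - d (y + 1) + d r / 2 * of_bool (y = r - 1)"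
    by linarith+
  then show ?thesis by (simp only:)
qed

lemma L_above_last:
  assumes "2 \<le> r" "x \<in> {0..r - 2}"
  shows "L $$ (x, r) = (- 1) ^ (x + r) * (b (r - 2) + d (r - 1) - b (r - 1) - d r / 2)"
proof -
  have "x + 2 \<le> r" using assms by auto
  then show ?thesis using L_above[of x r] L_superdiag_last by simp
qed

text \<open>The sign of the corner entry \<open>L (r - 1, r)\<close> comes from the entries above it. They alternate in
  sign, and there are at least two of them, so being nonnegative they vanish; by the recursion the
  corner is then the birth rate \<open>b (r - 2)\<close>.\<close>

lemma markov_generator_if_nonneg:
  assumes "3 \<le> r"
    and super: "\<And>y. y \<in> {1..r - 1} \<Longrightarrow> 0 \<le> L $$ (y - 1, y)"
    and above: "\<And>x y. y \<in> {2..r - 1} \<Longrightarrow> x \<in> {0..y - 2} \<Longrightarrow> 0 \<le> L $$ (x, y)"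
    and last: "\<And>x. x \<in> {0..r - 2} \<Longrightarrow> 0 \<le> L $$ (x, r)"
  shows "markov_generator r L"
proof -
  have "L $$ (r - 3, r) = - L $$ (r - 2, r)"
  proof -
    have "even (r - 2 + r)" "odd (r - 3 + r)" using assms(1) by auto
    then show ?thesis using L_above_last[of "r - 3"] L_above_last[of "r - 2"] assms(1) by simp
  qed
  moreover have "r - 3 \<in> {0..r - 2}" "r - 2 \<in> {0..r - 2}" by auto
  ultimately have "L $$ (r - 2, r) = 0" using last[of "r - 3"] last[of "r - 2"] by linarith
  then have "L $$ (r - 1, r) = b (r - 2)"
    using L_above[of "r - 2" r] assms(1) by simp
  then have corner: "0 < L $$ (r - 1, r)" using b_pos[of "r - 2"] assms(1) by simp
  have "0 \<le> L $$ (x, y)" if "x \<le> r" "y \<le> r" "x \<noteq> y" for x y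
  proof -
    consider "y + 1 < x" | "x = y + 1" | "y = x + 1" "y < r" | "x = r - 1" "y = r"
      | "x + 2 \<le> y" "y < r" | "x + 2 \<le> y" "y = r"
      using \<open>x \<le> r\<close> \<open>y \<le> r\<close> \<open>x \<noteq> y\<close> by linarith
    then show ?thesis
    proof cases
      case 1 then show ?thesis using that by (simp add: L_below)
    next
      case 2 then show ?thesis using that L_sub_pos[of y] by simp
    next
      case 3 then show ?thesis using super[of y] by simp
    next
      case 4 then show ?thesis using corner by simp
    next
      case 5
      then have "y \<in> {2..r - 1}" "x \<in> {0..y - 2}" by auto
      then show ?thesis by (rule above)
    next
      case 6
      then have "x \<in> {0..r - 2}" by auto
      then show ?thesis using last 6 by simp
    qed
  qed
  then show ?thesis using L_dim L_row_sum by (simp add: markov_generator_def)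
qed

end

section \<open>Orthonormal systems in weighted spaces\<close>

locale weighted_orthonormal_basis =
  fixes r :: nat and \<pi> :: "nat \<Rightarrow> real" and e :: "nat \<Rightarrow> nat \<Rightarrow> real"
  assumes orthonormal: "i \<le> r \<Longrightarrow> j \<le> r \<Longrightarrow> (\<Sum>x\<le>r. e i x * e j x * \<pi> x) = of_bool (i = j)"
begin

text \<open>Orthonormality says that the matrix with rows \<open>e j\<close> has the matrix with columns \<open>e j * \<pi>\<close> as a
  right inverse. Both are square because there are as many functions as states, so it is a left
  inverse as well, which is completeness.\<close>

lemma complete:
  assumes "x \<le> r" "y \<le> r"
  shows "(\<Sum>j\<le>r. e j x * (e j y * \<pi> y)) = of_bool (x = y)"
proof -
  define A where "A = mat (r + 1) (r + 1) (\<lambda>(j, x). e j x)"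
  define B where "B = mat (r + 1) (r + 1) (\<lambda>(x, j). e j x * \<pi> x)"
  have A: "A \<in> carrier_mat (r + 1) (r + 1)" and B: "B \<in> carrier_mat (r + 1) (r + 1)"
    by (simp_all add: A_def B_def)
  have "A * B = 1\<^sub>m (r + 1)"
  proof (rule eq_matI)
    fix i j assume "i < dim_row (1\<^sub>m (r + 1) :: real mat)" "j < dim_col (1\<^sub>m (r + 1) :: real mat)"
    then have ij: "i \<le> r" "j \<le> r" by auto
    have "(A * B) $$ (i, j) = (\<Sum>x\<le>r. e i x * e j x * \<pi> x)"
      unfolding mult_entry[OF A B ij] using ij by (intro sum.cong) (auto simp: A_def B_def)
    then show "(A * B) $$ (i, j) = 1\<^sub>m (r + 1) $$ (i, j)"
      using ij orthonormal by simp
  qed (simp_all add: A_def B_def)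
  then have "B * A = 1\<^sub>m (r + 1)" by (rule mat_mult_left_right_inverse[OF A B])
  then have "(\<Sum>j\<le>r. B $$ (y, j) * A $$ (j, x)) = of_bool (x = y)"
    using mult_entry[OF B A assms(2,1)] assms by auto
  moreover have "(\<Sum>j\<le>r. B $$ (y, j) * A $$ (j, x)) = (\<Sum>j\<le>r. e j x * (e j y * \<pi> y))"
    using assms by (intro sum.cong) (auto simp: A_def B_def)
  ultimately show ?thesis by simp
qed

lemma parseval: "(\<Sum>j\<le>r. (\<Sum>x\<le>r. e j x * \<pi> x * h x)\<^sup>2) = (\<Sum>x\<le>r. (h x)\<^sup>2 * \<pi> x)"
proof -
  have "(\<Sum>j\<le>r. (\<Sum>x\<le>r. e j x * \<pi> x * h x)\<^sup>2)
      = (\<Sum>j\<le>r. \<Sum>x\<le>r. \<Sum>y\<le>r. (e j x * \<pi> x * h x) * (e j y * \<pi> y * h y))"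
    by (simp add: power2_eq_square sum_product)
  also have "\<dots> = (\<Sum>x\<le>r. \<Sum>j\<le>r. \<Sum>y\<le>r. (e j x * \<pi> x * h x) * (e j y * \<pi> y * h y))"
    by (rule sum.swap)
  also have "\<dots> = (\<Sum>x\<le>r. \<Sum>y\<le>r. \<Sum>j\<le>r. (e j x * \<pi> x * h x) * (e j y * \<pi> y * h y))"
    by (intro sum.cong refl sum.swap)
  also have "\<dots> = (\<Sum>x\<le>r. \<Sum>y\<le>r. \<pi> x * h x * h y * (\<Sum>j\<le>r. e j x * (e j y * \<pi> y)))"
    by (simp add: sum_distrib_left mult_ac)
  also have "\<dots> = (\<Sum>x\<le>r. \<Sum>y\<le>r. if y = x then \<pi> x * h x * h y else 0)"
    by (intro sum.cong refl) (simp add: complete)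
  finally show ?thesis by (simp add: power2_eq_square mult_ac)
qed

lemma norm_combination:
  "(\<Sum>x\<le>r. (\<Sum>j\<le>r. a j * e j x)\<^sup>2 * \<pi> x) = (\<Sum>j\<le>r. (a j)\<^sup>2)"
proof -
  have "(\<Sum>x\<le>r. (\<Sum>j\<le>r. a j * e j x)\<^sup>2 * \<pi> x)
      = (\<Sum>x\<le>r. \<Sum>i\<le>r. \<Sum>j\<le>r. a i * a j * (e i x * e j x * \<pi> x))"
    unfolding power2_eq_square sum_product by (simp add: sum_distrib_left sum_distrib_right mult_ac)
  also have "\<dots> = (\<Sum>i\<le>r. \<Sum>x\<le>r. \<Sum>j\<le>r. a i * a j * (e i x * e j x * \<pi> x))"
    by (rule sum.swap)
  also have "\<dots> = (\<Sum>i\<le>r. \<Sum>j\<le>r. \<Sum>x\<le>r. a i * a j * (e i x * e j x * \<pi> x))"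
    by (intro sum.cong refl sum.swap)
  also have "\<dots> = (\<Sum>i\<le>r. \<Sum>j\<le>r. if j = i then a i * a j else 0)"
    by (intro sum.cong refl) (simp add: sum_distrib_left[symmetric] orthonormal)
  finally show ?thesis by (simp add: power2_eq_square)
qed

end

section \<open>Exponentials of diagonalisable matrices\<close>

text \<open>Right eigenvectors are inherited by all powers of \<open>A\<close>; expanding the unit vector at \<open>y\<close> in them by
  the resolution of the identity gives every power, and then the exponential series can be summed
  one eigenvalue at a time.\<close>

lemma mat_exp_spectral:
  assumes A: "A \<in> carrier_mat (r + 1) (r + 1)"
    and eigen: "\<And>j x. j \<in> J \<Longrightarrow> x \<le> r \<Longrightarrow> (\<Sum>k\<le>r. A $$ (x, k) * f j k) = \<mu> j * f j x"
    and resolution: "\<And>x y. x \<le> r \<Longrightarrow> y \<le> r \<Longrightarrow> (\<Sum>j\<in>J. f j x * g j y) = of_bool (x = y)"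
    and xy: "x \<le> r" "y \<le> r"
  shows "mat_exp A $$ (x, y) = (\<Sum>j\<in>J. exp (\<mu> j) * (f j x * g j y))"
proof -
  have An: "A ^\<^sub>m n \<in> carrier_mat (r + 1) (r + 1)" for n using A by simp
  have power_eigen: "(\<Sum>k\<le>r. (A ^\<^sub>m n) $$ (x, k) * f j k) = \<mu> j ^ n * f j x" if "j \<in> J" for n j
  proof (induction n)
    case 0
    have "(\<Sum>k\<le>r. (A ^\<^sub>m 0) $$ (x, k) * f j k) = (\<Sum>k\<le>r. if k = x then f j k else 0)"
      using A xy by (intro sum.cong) auto
    then show ?case using xy by simp
  next
    case (Suc n)
    have "(\<Sum>k\<le>r. (A ^\<^sub>m Suc n) $$ (x, k) * f j k)
        = (\<Sum>k\<le>r. \<Sum>l\<le>r. (A ^\<^sub>m n) $$ (x, l) * A $$ (l, k) * f j k)"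
      using xy by (simp add: mult_entry[OF An A] sum_distrib_right del: index_mult_mat)
    also have "\<dots> = (\<Sum>l\<le>r. \<Sum>k\<le>r. (A ^\<^sub>m n) $$ (x, l) * A $$ (l, k) * f j k)" by (rule sum.swap)
    also have "\<dots> = (\<Sum>l\<le>r. (A ^\<^sub>m n) $$ (x, l) * (\<Sum>k\<le>r. A $$ (l, k) * f j k))"
      by (simp add: sum_distrib_left mult.assoc)
    also have "\<dots> = (\<Sum>l\<le>r. \<mu> j * ((A ^\<^sub>m n) $$ (x, l) * f j l))"
      using that by (intro sum.cong) (simp_all add: eigen)
    also have "\<dots> = \<mu> j ^ Suc n * f j x"
      using Suc by (simp add: sum_distrib_left[symmetric])
    finally show ?case .
  qed
  have entry: "(A ^\<^sub>m n) $$ (x, y) = (\<Sum>j\<in>J. \<mu> j ^ n * (f j x * g j y))" for n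
  proof -
    have "(A ^\<^sub>m n) $$ (x, y) = (\<Sum>k\<le>r. (A ^\<^sub>m n) $$ (x, k) * of_bool (k = y))"
      using xy by (simp add: of_bool_def if_distrib cong: if_cong)
    also have "\<dots> = (\<Sum>k\<le>r. \<Sum>j\<in>J. (A ^\<^sub>m n) $$ (x, k) * (f j k * g j y))"
      unfolding sum_distrib_left[symmetric] using xy by (intro sum.cong) (simp_all add: resolution)
    also have "\<dots> = (\<Sum>j\<in>J. \<Sum>k\<le>r. (A ^\<^sub>m n) $$ (x, k) * (f j k * g j y))" by (rule sum.swap)
    also have "\<dots> = (\<Sum>j\<in>J. (\<Sum>k\<le>r. (A ^\<^sub>m n) $$ (x, k) * f j k) * g j y)"
      by (simp add: sum_distrib_right mult.assoc)
    also have "\<dots> = (\<Sum>j\<in>J. \<mu> j ^ n * (f j x * g j y))"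
      by (intro sum.cong) (simp_all add: power_eigen)
    finally show ?thesis .
  qed
  have "(\<lambda>n. (A ^\<^sub>m n) $$ (x, y) / fact n) = (\<lambda>n. \<Sum>j\<in>J. \<mu> j ^ n /\<^sub>R fact n * (f j x * g j y))"
    unfolding entry sum_divide_distrib by (intro ext sum.cong) (simp_all add: divide_inverse mult_ac)
  moreover have "(\<lambda>n. \<Sum>j\<in>J. \<mu> j ^ n /\<^sub>R fact n * (f j x * g j y))
      sums (\<Sum>j\<in>J. exp (\<mu> j) * (f j x * g j y))"
    by (intro sums_sum sums_mult2 exp_converges)
  ultimately show ?thesis using A xy by (simp add: mat_exp_def sums_iff)
qed

section \<open>Weighted operator norms and point evaluations\<close>

lemma l2_norm_eq:
  assumes "v \<in> carrier_vec (r + 1)"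
  shows "l2_norm \<pi> v = sqrt (\<Sum>x\<le>r. (v $ x)\<^sup>2 * \<pi> x)"
  using assms by (simp add: l2_norm_def l2_inner_eq power2_eq_square)

lemma l2_norm_nonneg:
  assumes "v \<in> carrier_vec (r + 1)" "\<And>x. x \<le> r \<Longrightarrow> 0 \<le> \<pi> x"
  shows "0 \<le> l2_norm \<pi> v"
  unfolding l2_norm_eq[OF assms(1)]
  by (intro real_sqrt_ge_zero sum_nonneg mult_nonneg_nonneg) (use assms in auto)

text \<open>A function of norm \<open>n\<close> is at most \<open>n / sqrt (\<pi> k)\<close> at the state \<open>k\<close>. The resulting crude constant
  serves to show that the supremum defining the operator norm is over a bounded set, without which
  it would have no meaning.\<close>

lemma l2_norm_mult_bounded:
  assumes A: "A \<in> carrier_mat (r + 1) (r + 1)"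
    and \<pi>: "\<And>x. x \<le> r \<Longrightarrow> 0 < \<pi> x" and \<rho>: "\<And>x. x \<le> r \<Longrightarrow> 0 \<le> \<rho> x"
  obtains C where "\<And>v. v \<in> carrier_vec (r + 1) \<Longrightarrow> l2_norm \<rho> (A *\<^sub>v v) \<le> C * l2_norm \<pi> v"
proof -
  define c where "c x = (\<Sum>k\<le>r. \<bar>A $$ (x, k)\<bar> / sqrt (\<pi> k))" for x
  have "l2_norm \<rho> (A *\<^sub>v v) \<le> sqrt (\<Sum>x\<le>r. (c x)\<^sup>2 * \<rho> x) * l2_norm \<pi> v"
    if v: "v \<in> carrier_vec (r + 1)" for v
  proof -
    let ?n = "l2_norm \<pi> v"
    have n: "0 \<le> ?n" using l2_norm_nonneg[OF v] \<pi> by (simp add: less_imp_le)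
    have coord: "\<bar>v $ k\<bar> \<le> ?n / sqrt (\<pi> k)" if "k \<le> r" for k
    proof -
      have "(v $ k)\<^sup>2 * \<pi> k \<le> (\<Sum>x\<le>r. (v $ x)\<^sup>2 * \<pi> x)"
        using that \<pi> by (intro member_le_sum) (auto simp: less_imp_le)
      then have "sqrt ((v $ k)\<^sup>2 * \<pi> k) \<le> ?n" by (simp add: l2_norm_eq[OF v])
      then show ?thesis using \<pi>[OF that] by (simp add: real_sqrt_mult field_simps)
    qed
    have "((A *\<^sub>v v) $ x)\<^sup>2 * \<rho> x \<le> (?n * c x)\<^sup>2 * \<rho> x" if "x \<le> r" for x
    proof -
      have "\<bar>(A *\<^sub>v v) $ x\<bar> \<le> (\<Sum>k\<le>r. \<bar>A $$ (x, k) * v $ k\<bar>)"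
        unfolding mult_vec_entry[OF A v that] by (rule sum_abs)
      also have "\<dots> \<le> (\<Sum>k\<le>r. \<bar>A $$ (x, k)\<bar> * (?n / sqrt (\<pi> k)))"
        unfolding abs_mult by (intro sum_mono mult_left_mono coord) auto
      also have "\<dots> = ?n * c x" by (simp add: c_def sum_distrib_left mult_ac)
      finally have "((A *\<^sub>v v) $ x)\<^sup>2 \<le> (?n * c x)\<^sup>2" by (simp add: abs_le_square_iff[symmetric])
      then show ?thesis using \<rho>[OF that] by (rule mult_right_mono)
    qed
    then have "(\<Sum>x\<le>r. ((A *\<^sub>v v) $ x)\<^sup>2 * \<rho> x) \<le> (\<Sum>x\<le>r. (?n * c x)\<^sup>2 * \<rho> x)"
      by (intro sum_mono) auto
    also have "\<dots> = ?n\<^sup>2 * (\<Sum>x\<le>r. (c x)\<^sup>2 * \<rho> x)"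
      by (simp add: sum_distrib_left power_mult_distrib mult_ac)
    finally have "sqrt (\<Sum>x\<le>r. ((A *\<^sub>v v) $ x)\<^sup>2 * \<rho> x) \<le> sqrt (?n\<^sup>2 * (\<Sum>x\<le>r. (c x)\<^sup>2 * \<rho> x))"
      by (rule real_sqrt_le_mono)
    moreover have "A *\<^sub>v v \<in> carrier_vec (r + 1)" using A v by simp
    ultimately show ?thesis
      using n by (simp add: l2_norm_eq[of "A *\<^sub>v v" r] real_sqrt_mult mult.commute)
  qed
  then show thesis by (rule that)
qed

lemma l2_norm_mult_le_opnorm:
  assumes A: "A \<in> carrier_mat (r + 1) (r + 1)"
    and \<pi>: "\<And>x. x \<le> r \<Longrightarrow> 0 < \<pi> x" and \<rho>: "\<And>x. x \<le> r \<Longrightarrow> 0 \<le> \<rho> x"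
    and v: "v \<in> carrier_vec (r + 1)"
  shows "l2_norm \<rho> (A *\<^sub>v v) \<le> l2_opnorm \<pi> \<rho> A * l2_norm \<pi> v"
    and "0 \<le> l2_opnorm \<pi> \<rho> A"
proof -
  let ?V = "carrier_vec (r + 1) - {0\<^sub>v (r + 1)} :: real vec set"
  let ?q = "\<lambda>v. l2_norm \<rho> (A *\<^sub>v v) / l2_norm \<pi> v"
  obtain C where C: "\<And>v. v \<in> carrier_vec (r + 1) \<Longrightarrow> l2_norm \<rho> (A *\<^sub>v v) \<le> C * l2_norm \<pi> v"
    using l2_norm_mult_bounded[of A r \<pi> \<rho>] A \<pi> \<rho> by blast
  have pos: "0 < l2_norm \<pi> v" if v: "v \<in> ?V" for v
  proof -
    obtain k where k: "k \<le> r" "v $ k \<noteq> 0"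
      using v by (metis DiffE eq_vecI index_zero_vec carrier_vecD insertI1 less_Suc_eq_le Suc_eq_plus1)
    then have "0 < (v $ k)\<^sup>2 * \<pi> k" using \<pi> by simp
    also have "\<dots> \<le> (\<Sum>x\<le>r. (v $ x)\<^sup>2 * \<pi> x)"
      using k \<pi> by (intro member_le_sum) (auto simp: less_imp_le)
    finally show ?thesis using v by (simp add: l2_norm_eq[of v r])
  qed
  have "bdd_above (?q ` ?V)"
    using C pos by (intro bdd_aboveI2[where M = C]) (simp add: divide_le_eq)
  then have upper: "?q v \<le> l2_opnorm \<pi> \<rho> A" if "v \<in> ?V" for v
    using that A unfolding l2_opnorm_def by (auto intro!: cSUP_upper)
  show "l2_norm \<rho> (A *\<^sub>v v) \<le> l2_opnorm \<pi> \<rho> A * l2_norm \<pi> v"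
  proof (cases "v = 0\<^sub>v (r + 1)")
    case True
    then have "l2_norm \<pi> v = 0" by (subst l2_norm_eq[OF v]) simp
    then show ?thesis using C[OF v] by simp
  next
    case False
    then show ?thesis using upper[of v] pos[of v] v by (simp add: divide_le_eq)
  qed
  have "unit_vec (r + 1) 0 \<in> ?V"
    by (auto simp: vec_eq_iff)
  moreover have "0 \<le> ?q (unit_vec (r + 1) 0)"
    using A \<pi> \<rho> by (intro divide_nonneg_nonneg l2_norm_nonneg[where r = r]) (auto simp: less_imp_le)
  ultimately show "0 \<le> l2_opnorm \<pi> \<rho> A" by (meson upper order_trans)
qed

text \<open>Mean zero means that \<open>p x * u x\<close> is minus the integral of \<open>u\<close> over the other states, whose
  mass is \<open>1 - p x\<close>. The Cauchy-Schwarz inequality on those states, rather than on all of them,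
  is what produces the factor \<open>1 - p x\<close>.\<close>

lemma point_evaluation_bound:
  fixes p u :: "nat \<Rightarrow> real"
  assumes pos: "\<And>y. y \<le> r \<Longrightarrow> 0 < p y" and total: "(\<Sum>y\<le>r. p y) = 1"
    and mean: "(\<Sum>y\<le>r. p y * u y) = 0" and "x \<le> r"
  shows "\<bar>u x\<bar> \<le> sqrt ((1 - p x) / p x) * sqrt (\<Sum>y\<le>r. (u y)\<^sup>2 * p y)"
proof -
  let ?R = "{..r} - {x}"
  define q where "q = (\<Sum>y\<in>?R. p y)"
  define s where "s = (\<Sum>y\<in>?R. p y * u y)"
  define T where "T = (\<Sum>y\<in>?R. (u y)\<^sup>2 * p y)"
  have q: "q = 1 - p x" and s: "s = - (p x * u x)"
    and N: "(\<Sum>y\<le>r. (u y)\<^sup>2 * p y) = (u x)\<^sup>2 * p x + T"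
    using total mean \<open>x \<le> r\<close> by (simp_all add: q_def s_def T_def sum.remove[of "{..r}" x])
  have cauchy_schwarz: "s\<^sup>2 \<le> q * T"
  proof (cases "?R = {}")
    case True
    then show ?thesis by (simp only: q_def s_def T_def) simp
  next
    case False
    then have "0 < q" unfolding q_def by (intro sum_pos) (use pos in auto)
    \<comment> \<open>\<open>q\<^sup>2\<close> times the integral over \<open>?R\<close> of the squared deviation of \<open>u\<close> from its average \<open>s / q\<close>\<close>
    have "0 \<le> (\<Sum>y\<in>?R. p y * (q * u y - s)\<^sup>2)"
      using pos by (intro sum_nonneg) (auto simp: less_imp_le)
    also have "\<dots> = (\<Sum>y\<in>?R. q\<^sup>2 * ((u y)\<^sup>2 * p y) - 2 * q * s * (p y * u y) + s\<^sup>2 * p y)"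
      by (intro sum.cong) (simp_all add: power2_eq_square algebra_simps)
    also have "\<dots> = q\<^sup>2 * T - 2 * q * s * s + s\<^sup>2 * q"
      by (simp add: sum.distrib sum_subtractf sum_distrib_left[symmetric] q_def s_def T_def)
    also have "\<dots> = q * (q * T - s\<^sup>2)" by (simp add: power2_eq_square algebra_simps)
    finally show ?thesis using \<open>0 < q\<close> by (simp add: zero_le_mult_iff)
  qed
  have px: "0 < p x" using pos \<open>x \<le> r\<close> by simp
  have "(u x)\<^sup>2 * p x * p x + (u x)\<^sup>2 * p x * q \<le> q * T + (u x)\<^sup>2 * p x * q"
    using cauchy_schwarz by (simp add: s power_mult_distrib power2_eq_square mult_ac)
  then have "(u x)\<^sup>2 * p x \<le> (1 - p x) * ((u x)\<^sup>2 * p x + T)"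
    by (simp add: q algebra_simps)
  then have "(u x)\<^sup>2 \<le> (1 - p x) / p x * (\<Sum>y\<le>r. (u y)\<^sup>2 * p y)"
    using px by (simp add: N pos_le_divide_eq)
  then have "sqrt ((u x)\<^sup>2) \<le> sqrt ((1 - p x) / p x * (\<Sum>y\<le>r. (u y)\<^sup>2 * p y))"
    by (rule real_sqrt_le_mono)
  then show ?thesis by (simp only: real_sqrt_abs real_sqrt_mult)
qed

section \<open>The intertwined semigroup\<close>

lemma pb_measure_mult_pb_dual:
  assumes "0 < pb_measure r \<pi> y"
  shows "pb_dual r \<pi> \<phi> y * pb_measure r \<pi> y
    = \<phi> $ (y - 1) * \<pi> (y - 1) / 2 * of_bool (1 \<le> y)
      + \<phi> $ y * \<pi> y * (of_bool (y \<noteq> r) / 2 + of_bool (y = r))"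
  using assms by (simp add: pb_dual_def)

lemma pb_dual_push_forward:
  assumes "0 < pb_measure r \<pi> y" "y \<le> r"
  shows "pb_dual r \<pi> \<phi> y * pb_measure r \<pi> y
    = (\<Sum>k\<le>r. \<phi> $ k * \<pi> k * pure_birth_link r $$ (k, y))"
  unfolding pb_measure_mult_pb_dual[OF assms(1)] pure_birth_link_push_forward[OF assms(2)] ..

locale pure_birth_spectral = pure_birth_intertwining r b d L
  for r :: nat and b d :: "nat \<Rightarrow> real" and L :: "real mat" +
  fixes \<pi> lam :: "nat \<Rightarrow> real" and \<phi> :: "nat \<Rightarrow> real vec"
  assumes prob: "prob_on r \<pi>"
    and rev: "reversible r (birth_death_generator r b d) \<pi>"
    and eigen: "j \<le> r \<Longrightarrow> eigenvector (birth_death_generator r b d) (\<phi> j) (- lam j)"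
    and orthonormal: "i \<le> r \<Longrightarrow> j \<le> r \<Longrightarrow> l2_inner \<pi> (\<phi> i) (\<phi> j) = of_bool (i = j)"
begin

lemma \<pi>_pos: "x \<le> r \<Longrightarrow> 0 < \<pi> x"
  using reversible_measure_pos[OF rates prob rev] .

lemma pb_pos: "x \<le> r \<Longrightarrow> 0 < pb_measure r \<pi> x"
  by (rule pb_measure_pos[OF \<pi>_pos])

lemma \<phi>_carrier: "j \<le> r \<Longrightarrow> \<phi> j \<in> carrier_vec (r + 1)"
  using eigen[of j] by (simp add: eigenvector_def birth_death_generator_def)

lemma G_\<phi>:
  assumes "j \<le> r" "x \<le> r"
  shows "(\<Sum>k\<le>r. birth_death_generator r b d $$ (x, k) * \<phi> j $ k) = - lam j * \<phi> j $ x"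
proof -
  have "(birth_death_generator r b d *\<^sub>v \<phi> j) $ x = (- lam j \<cdot>\<^sub>v \<phi> j) $ x"
    using eigen[OF assms(1)] by (simp add: eigenvector_def)
  then show ?thesis
    using mult_vec_entry[OF birth_death_generator_carrier \<phi>_carrier[OF assms(1)] assms(2)]
      \<phi>_carrier[OF assms(1)] assms(2) by simp
qed

sublocale basis: weighted_orthonormal_basis r \<pi> "\<lambda>j x. \<phi> j $ x"
proof
  fix i j assume "i \<le> r" "j \<le> r"
  then show "(\<Sum>x\<le>r. \<phi> i $ x * \<phi> j $ x * \<pi> x) = of_bool (i = j)"
    using orthonormal l2_inner_eq[OF \<phi>_carrier] by simp
qed

text \<open>Under the link both sides become \<open>G \<phi>\<^sub>j = - \<lambda>\<^sub>j \<phi>\<^sub>j\<close>.\<close>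

lemma L_lift:
  assumes "j \<le> r" "x \<le> r"
  shows "(\<Sum>k\<le>r. L $$ (x, k) * pb_lift r (\<phi> j) k) = - lam j * pb_lift r (\<phi> j) x"
  using _ assms(2)
proof (rule pure_birth_link_inject)
  fix x assume x: "x \<le> r"
  have "(\<Sum>k\<le>r. birth_death_generator r b d $$ (x, k)
        * (\<Sum>y\<le>r. pure_birth_link r $$ (k, y) * pb_lift r (\<phi> j) y))
      = (\<Sum>k\<le>r. birth_death_generator r b d $$ (x, k) * \<phi> j $ k)"
    by (intro sum.cong refl) (simp only: atMost_iff pb_lift_solves)
  also have "\<dots> = - lam j * (\<Sum>k\<le>r. pure_birth_link r $$ (x, k) * pb_lift r (\<phi> j) k)"
    using assms(1) x by (simp only: G_\<phi> pb_lift_solves)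
  finally show "(\<Sum>k\<le>r. pure_birth_link r $$ (x, k) * (\<Sum>y\<le>r. L $$ (k, y) * pb_lift r (\<phi> j) y))
      = (\<Sum>k\<le>r. pure_birth_link r $$ (x, k) * (- lam j * pb_lift r (\<phi> j) k))"
    unfolding link_apply[OF x] by (simp add: sum_distrib_left mult_ac)
qed

text \<open>Under the link the lifts become the \<open>\<phi>\<^sub>j\<close>, and the duals are the functions \<open>\<phi>\<^sub>j \<pi>\<close> pushed forward by
  the link. Completeness of the \<open>\<phi>\<^sub>j\<close> therefore turns the left-hand side into the link itself.\<close>

lemma lift_dual_resolution:
  assumes "x \<le> r" "y \<le> r"
  shows "(\<Sum>j\<le>r. pb_lift r (\<phi> j) x * (pb_dual r \<pi> (\<phi> j) y * pb_measure r \<pi> y)) = of_bool (x = y)"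
  using _ assms(1)
proof (rule pure_birth_link_inject)
  fix x assume x: "x \<le> r"
  let ?w = "\<lambda>j. pb_dual r \<pi> (\<phi> j) y * pb_measure r \<pi> y"
  have "(\<Sum>k\<le>r. pure_birth_link r $$ (x, k) * (\<Sum>j\<le>r. pb_lift r (\<phi> j) k * ?w j))
      = (\<Sum>k\<le>r. \<Sum>j\<le>r. pure_birth_link r $$ (x, k) * pb_lift r (\<phi> j) k * ?w j)"
    by (simp add: sum_distrib_left mult.assoc)
  also have "\<dots> = (\<Sum>j\<le>r. \<Sum>k\<le>r. pure_birth_link r $$ (x, k) * pb_lift r (\<phi> j) k * ?w j)"
    by (rule sum.swap)
  also have "\<dots> = (\<Sum>j\<le>r. \<phi> j $ x * ?w j)"
    unfolding sum_distrib_right[symmetric] by (simp only: pb_lift_solves x)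
  also have "\<dots> = (\<Sum>j\<le>r. \<Sum>k\<le>r. \<phi> j $ x * (\<phi> j $ k * \<pi> k) * pure_birth_link r $$ (k, y))"
    using assms(2) pb_pos by (simp add: pb_dual_push_forward sum_distrib_left mult.assoc)
  also have "\<dots> = (\<Sum>k\<le>r. \<Sum>j\<le>r. \<phi> j $ x * (\<phi> j $ k * \<pi> k) * pure_birth_link r $$ (k, y))"
    by (rule sum.swap)
  also have "\<dots> = (\<Sum>k\<le>r. of_bool (x = k) * pure_birth_link r $$ (k, y))"
    unfolding sum_distrib_right[symmetric]
    by (intro sum.cong refl) (simp only: atMost_iff basis.complete x)
  also have "\<dots> = (\<Sum>k\<le>r. if x = k then pure_birth_link r $$ (k, y) else 0)"
    by (intro sum.cong) auto
  also have "\<dots> = pure_birth_link r $$ (x, y)" using x by simp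
  also have "\<dots> = (\<Sum>k\<le>r. pure_birth_link r $$ (x, k) * of_bool (k = y))"
    using assms(2) by (simp add: of_bool_def if_distrib cong: if_cong)
  finally show "(\<Sum>k\<le>r. pure_birth_link r $$ (x, k) * (\<Sum>j\<le>r. pb_lift r (\<phi> j) k * ?w j))
      = (\<Sum>k\<le>r. pure_birth_link r $$ (x, k) * of_bool (k = y))" .
qed

lemma semigroup_spectral:
  assumes "x \<le> r" "y \<le> r"
  shows "transition_semigroup L t $$ (x, y)
    = (\<Sum>j\<le>r. exp (- lam j * t) * (pb_lift r (\<phi> j) x * (pb_dual r \<pi> (\<phi> j) y * pb_measure r \<pi> y)))"
  unfolding transition_semigroup_def
proof (rule mat_exp_spectral)
  show "t \<cdot>\<^sub>m L \<in> carrier_mat (r + 1) (r + 1)" using L_dim by simp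
  fix j x assume "j \<in> {..r}" and x: "x \<le> r"
  have "(\<Sum>k\<le>r. (t \<cdot>\<^sub>m L) $$ (x, k) * pb_lift r (\<phi> j) k)
      = t * (\<Sum>k\<le>r. L $$ (x, k) * pb_lift r (\<phi> j) k)"
    using x L_dim unfolding sum_distrib_left by (intro sum.cong) (auto simp: mult_ac)
  then show "(\<Sum>k\<le>r. (t \<cdot>\<^sub>m L) $$ (x, k) * pb_lift r (\<phi> j) k) = - lam j * t * pb_lift r (\<phi> j) x"
    using L_lift[of j x] \<open>j \<in> {..r}\<close> x by simp
qed (use assms lift_dual_resolution in auto)

text \<open>The eigenfunction for the eigenvalue \<open>0\<close> is constant, and the normalisation leaves only its sign
  \<open>c\<close> undetermined. As \<open>c * c = 1\<close>, its term in the spectral decomposition is exactly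
  \<open>pb_measure r \<pi>\<close>.\<close>

lemma ground_state:
  assumes "lam 0 = 0"
  obtains c where "c * c = 1" "\<And>x. x \<le> r \<Longrightarrow> \<phi> 0 $ x = c" "\<And>x. x \<le> r \<Longrightarrow> pb_lift r (\<phi> 0) x = c"
    "\<And>y. y \<le> r \<Longrightarrow> pb_dual r \<pi> (\<phi> 0) y * pb_measure r \<pi> y = c * pb_measure r \<pi> y"
proof -
  define c where "c = \<phi> 0 $ 0"
  have const: "\<phi> 0 $ x = c" if "x \<le> r" for x
    unfolding c_def by (rule birth_death_harmonic_const[OF rates _ that])
      (use G_\<phi>[of 0] assms in simp)
  have "(\<Sum>x\<le>r. \<phi> 0 $ x * \<phi> 0 $ x * \<pi> x) = c * c * (\<Sum>x\<le>r. \<pi> x)"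
    by (simp add: const sum_distrib_left)
  then have "c * c = 1" using basis.orthonormal[of 0 0] prob by (simp add: prob_on_def)
  moreover have "pb_lift r (\<phi> 0) x = c" if "x \<le> r" for x
    using _ that
  proof (rule pure_birth_link_inject)
    fix x assume x: "x \<le> r"
    then show "(\<Sum>y\<le>r. pure_birth_link r $$ (x, y) * pb_lift r (\<phi> 0) y)
        = (\<Sum>y\<le>r. pure_birth_link r $$ (x, y) * c)"
      by (simp only: pb_lift_solves pure_birth_link_apply const) simp
  qed
  moreover have "pb_dual r \<pi> (\<phi> 0) y * pb_measure r \<pi> y = c * pb_measure r \<pi> y" if "y \<le> r" for y
    unfolding pb_dual_push_forward[OF pb_pos[OF that] that]
    unfolding pb_measure_eq[OF that]
    by (simp add: const sum_distrib_left mult.assoc)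
  ultimately show thesis using const that by blast
qed

text \<open>The operator \<open>P\<^sub>t - \<pi>\<^sub>L\<close> is tested against the sign \<open>g\<close> of its own row. The result \<open>u\<close> is carried
  to \<open>\<ell>\<^sup>2(\<pi>)\<close> by the link, where orthonormality gives the decay, and is brought back by the inverse.\<close>

lemma decay_bound:
  assumes lam_0: "lam 0 = 0" and gap: "\<And>j. 1 \<le> j \<Longrightarrow> j \<le> r \<Longrightarrow> lam 1 \<le> lam j"
    and t: "0 \<le> t" and x: "x \<le> r"
  shows "(\<Sum>y\<le>r. \<bar>transition_semigroup L t $$ (x, y) - pb_measure r \<pi> y\<bar>)
    \<le> condition_number (pb_measure r \<pi>) \<pi> (pure_birth_link r) * exp (- lam 1 * t)
      * sqrt ((1 - pb_measure r \<pi> x) / pb_measure r \<pi> x)"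
proof -
  let ?\<Lambda> = "pure_birth_link r" and ?p = "pb_measure r \<pi>"
  let ?w = "\<lambda>j y. pb_dual r \<pi> (\<phi> j) y * ?p y"
  define g where "g y = sgn (transition_semigroup L t $$ (x, y) - ?p y)" for y
  \<comment> \<open>coefficients of \<open>\<Lambda> g\<close> in the basis, and of its image under \<open>e\<^sup>t\<^sup>G - \<pi>\<close>\<close>
  define c where "c j = (\<Sum>k\<le>r. \<phi> j $ k * \<pi> k * (\<Sum>y\<le>r. ?\<Lambda> $$ (k, y) * g y))" for j
  define a where "a j = (if j = 0 then 0 else exp (- lam j * t) * c j)" for j
  define u where "u z = (\<Sum>j\<le>r. a j * pb_lift r (\<phi> j) z)" for z
  obtain s where s: "s * s = 1" and \<phi>0: "\<And>x. x \<le> r \<Longrightarrow> \<phi> 0 $ x = s"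
    and lift0: "\<And>x. x \<le> r \<Longrightarrow> pb_lift r (\<phi> 0) x = s"
    and dual0: "\<And>y. y \<le> r \<Longrightarrow> ?w 0 y = s * ?p y"
    using ground_state[OF lam_0] by blast
  have c: "c j = (\<Sum>y\<le>r. ?w j y * g y)" for j
  proof -
    have "c j = (\<Sum>k\<le>r. \<Sum>y\<le>r. \<phi> j $ k * \<pi> k * ?\<Lambda> $$ (k, y) * g y)"
      by (simp add: c_def sum_distrib_left mult.assoc)
    also have "\<dots> = (\<Sum>y\<le>r. \<Sum>k\<le>r. \<phi> j $ k * \<pi> k * ?\<Lambda> $$ (k, y) * g y)" by (rule sum.swap)
    also have "\<dots> = (\<Sum>y\<le>r. ?w j y * g y)"
      by (simp add: pb_dual_push_forward pb_pos sum_distrib_right)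
    finally show ?thesis .
  qed
  \<comment> \<open>subtracting the invariant measure removes the term \<open>j = 0\<close>\<close>
  have row: "transition_semigroup L t $$ (x, y) - ?p y
      = (\<Sum>j\<le>r. (if j = 0 then 0 else exp (- lam j * t)) * (pb_lift r (\<phi> j) x * ?w j y))"
    if y: "y \<le> r" for y
  proof -
    have "transition_semigroup L t $$ (x, y)
        = exp (- lam 0 * t) * (pb_lift r (\<phi> 0) x * ?w 0 y)
          + (\<Sum>j\<in>{..r} - {0}. exp (- lam j * t) * (pb_lift r (\<phi> j) x * ?w j y))"
      unfolding semigroup_spectral[OF x y] by (rule sum.remove) auto
    also have "exp (- lam 0 * t) * (pb_lift r (\<phi> 0) x * ?w 0 y) = ?p y"
      using s by (simp add: lam_0 lift0[OF x] dual0[OF y] flip: mult.assoc)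
    also have "(\<Sum>j\<in>{..r} - {0}. exp (- lam j * t) * (pb_lift r (\<phi> j) x * ?w j y))
        = (\<Sum>j\<in>{..r}. (if j = 0 then 0 else exp (- lam j * t)) * (pb_lift r (\<phi> j) x * ?w j y))"
      by (rule sum.mono_neutral_cong_left) auto
    finally show ?thesis by simp
  qed
  have "(\<Sum>y\<le>r. \<bar>transition_semigroup L t $$ (x, y) - ?p y\<bar>)
      = (\<Sum>y\<le>r. (transition_semigroup L t $$ (x, y) - ?p y) * g y)"
    by (simp add: g_def abs_sgn)
  also have "\<dots> = (\<Sum>y\<le>r. \<Sum>j\<le>r.
      (if j = 0 then 0 else exp (- lam j * t)) * (pb_lift r (\<phi> j) x * ?w j y) * g y)"
    unfolding sum_distrib_right[symmetric] by (intro sum.cong refl) (simp only: atMost_iff row)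
  also have "\<dots> = (\<Sum>j\<le>r. \<Sum>y\<le>r.
      (if j = 0 then 0 else exp (- lam j * t)) * (pb_lift r (\<phi> j) x * ?w j y) * g y)"
    by (rule sum.swap)
  also have "\<dots> = (\<Sum>j\<le>r. (if j = 0 then 0 else exp (- lam j * t)) * pb_lift r (\<phi> j) x * c j)"
    by (simp add: c sum_distrib_left mult_ac)
  also have "\<dots> = u x" unfolding u_def a_def by (intro sum.cong) auto
  finally have l1: "(\<Sum>y\<le>r. \<bar>transition_semigroup L t $$ (x, y) - ?p y\<bar>) = u x" .

  have link_u: "(\<Sum>y\<le>r. ?\<Lambda> $$ (z, y) * u y) = (\<Sum>j\<le>r. a j * \<phi> j $ z)" if z: "z \<le> r" for z
  proof -
    have "(\<Sum>y\<le>r. ?\<Lambda> $$ (z, y) * u y) = (\<Sum>y\<le>r. \<Sum>j\<le>r. a j * (?\<Lambda> $$ (z, y) * pb_lift r (\<phi> j) y))"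
      by (simp add: u_def sum_distrib_left mult_ac)
    also have "\<dots> = (\<Sum>j\<le>r. \<Sum>y\<le>r. a j * (?\<Lambda> $$ (z, y) * pb_lift r (\<phi> j) y))" by (rule sum.swap)
    also have "\<dots> = (\<Sum>j\<le>r. a j * \<phi> j $ z)"
      unfolding sum_distrib_left[symmetric] by (simp only: pb_lift_solves z)
    finally show ?thesis .
  qed
  \<comment> \<open>the mean of \<open>u\<close> is that of \<open>\<Lambda> u\<close> under \<open>\<pi>\<close>, which has no component along \<open>\<phi> 0\<close>\<close>
  have mean: "(\<Sum>y\<le>r. ?p y * u y) = 0"
  proof -
    have "(\<Sum>y\<le>r. ?p y * u y) = (\<Sum>y\<le>r. \<Sum>z\<le>r. \<pi> z * ?\<Lambda> $$ (z, y) * u y)"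
      by (simp add: pb_measure_eq sum_distrib_right)
    also have "\<dots> = (\<Sum>z\<le>r. \<Sum>y\<le>r. \<pi> z * ?\<Lambda> $$ (z, y) * u y)" by (rule sum.swap)
    also have "\<dots> = (\<Sum>z\<le>r. \<pi> z * (\<Sum>j\<le>r. a j * \<phi> j $ z))"
      by (intro sum.cong refl) (simp add: sum_distrib_left[symmetric] mult.assoc link_u)
    also have "\<dots> = (\<Sum>z\<le>r. \<Sum>j\<le>r. a j * s * (\<phi> 0 $ z * \<phi> j $ z * \<pi> z))"
    proof (intro sum.cong refl)
      fix z assume "z \<in> {..r}"
      then have "s * \<phi> 0 $ z = 1" using s \<phi>0 by simp
      then have "a j * s * (\<phi> 0 $ z * \<phi> j $ z * \<pi> z) = \<pi> z * (a j * \<phi> j $ z)" for j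
        by (metis mult.assoc mult.commute mult.left_neutral)
      then show "\<pi> z * (\<Sum>j\<le>r. a j * \<phi> j $ z) = (\<Sum>j\<le>r. a j * s * (\<phi> 0 $ z * \<phi> j $ z * \<pi> z))"
        by (simp only: sum_distrib_left)
    qed
    also have "\<dots> = (\<Sum>j\<le>r. \<Sum>z\<le>r. a j * s * (\<phi> 0 $ z * \<phi> j $ z * \<pi> z))" by (rule sum.swap)
    also have "\<dots> = (\<Sum>j\<le>r. a j * s * of_bool (0 = j))"
      unfolding sum_distrib_left[symmetric] by (intro sum.cong refl) (simp add: basis.orthonormal)
    also have "\<dots> = 0" by (intro sum.neutral) (auto simp: a_def)
    finally show ?thesis .
  qed

  obtain B where B: "mat_inverse ?\<Lambda> = Some B" "B \<in> carrier_mat (r + 1) (r + 1)"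
    "?\<Lambda> * B = 1\<^sub>m (r + 1)" "B * ?\<Lambda> = 1\<^sub>m (r + 1)"
    by (rule pure_birth_link_inverse)
  let ?gv = "vec (r + 1) g" and ?uv = "vec (r + 1) u"
  define wv where "wv = ?\<Lambda> *\<^sub>v ?uv"
  have wv: "wv \<in> carrier_vec (r + 1)"
    unfolding wv_def by (rule mult_mat_vec_carrier[OF pure_birth_link_carrier]) simp
  have wv_entry: "wv $ z = (\<Sum>j\<le>r. a j * \<phi> j $ z)" if "z \<le> r" for z
  proof -
    have "wv $ z = (\<Sum>k\<le>r. ?\<Lambda> $$ (z, k) * ?uv $ k)"
      unfolding wv_def by (rule mult_vec_entry) (use that pure_birth_link_carrier in auto)
    then show ?thesis using link_u[OF that] by simp
  qed
  have "B *\<^sub>v wv = (B * ?\<Lambda>) *\<^sub>v ?uv"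
    unfolding wv_def using B(2) pure_birth_link_carrier
    by (intro assoc_mult_mat_vec[symmetric, where n\<^sub>2 = "r + 1" and n\<^sub>3 = "r + 1"]) auto
  then have uv: "?uv = B *\<^sub>v wv" unfolding B(4) by simp
  have "l2_norm \<pi> wv = sqrt (\<Sum>j\<le>r. (a j)\<^sup>2)"
    using basis.norm_combination[of a] by (simp add: l2_norm_eq[OF wv] wv_entry)
  also have "\<dots> \<le> sqrt (\<Sum>j\<le>r. (exp (- lam 1 * t))\<^sup>2 * (c j)\<^sup>2)"
  proof (intro real_sqrt_le_mono sum_mono)
    fix j assume "j \<in> {..r}"
    show "(a j)\<^sup>2 \<le> (exp (- lam 1 * t))\<^sup>2 * (c j)\<^sup>2"
    proof (cases "j = 0")
      case False
      then have "exp (- lam j * t) \<le> exp (- lam 1 * t)"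
        using gap[of j] \<open>j \<in> {..r}\<close> t by (simp add: mult_right_mono)
      then have "(exp (- lam j * t))\<^sup>2 \<le> (exp (- lam 1 * t))\<^sup>2" by (intro power_mono) auto
      then show ?thesis using False by (simp add: a_def power_mult_distrib mult_right_mono)
    qed (simp add: a_def)
  qed
  also have "\<dots> = exp (- lam 1 * t) * sqrt (\<Sum>j\<le>r. (c j)\<^sup>2)"
    by (simp add: sum_distrib_left[symmetric] real_sqrt_mult)
  also have "sqrt (\<Sum>j\<le>r. (c j)\<^sup>2) = l2_norm \<pi> (?\<Lambda> *\<^sub>v ?gv)"
  proof -
    have "(?\<Lambda> *\<^sub>v ?gv) $ k = (\<Sum>y\<le>r. ?\<Lambda> $$ (k, y) * g y)" if "k \<le> r" for k
    proof -
      have "(?\<Lambda> *\<^sub>v ?gv) $ k = (\<Sum>y\<le>r. ?\<Lambda> $$ (k, y) * ?gv $ y)"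
        by (rule mult_vec_entry) (use that pure_birth_link_carrier in auto)
      then show ?thesis by simp
    qed
    moreover have "?\<Lambda> *\<^sub>v ?gv \<in> carrier_vec (r + 1)"
      by (rule mult_mat_vec_carrier[OF pure_birth_link_carrier]) simp
    ultimately show ?thesis
      by (simp add: l2_norm_eq[where r = r] c_def basis.parseval)
  qed
  also have "\<dots> \<le> l2_opnorm ?p \<pi> ?\<Lambda> * l2_norm ?p ?gv"
    by (rule l2_norm_mult_le_opnorm[OF pure_birth_link_carrier])
      (use pb_pos \<pi>_pos in \<open>auto simp: less_imp_le\<close>)
  also have "\<dots> \<le> l2_opnorm ?p \<pi> ?\<Lambda> * 1"
  proof (intro mult_left_mono)
    have "(\<Sum>y\<le>r. (g y)\<^sup>2 * ?p y) \<le> (\<Sum>y\<le>r. ?p y)"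
      by (intro sum_mono) (use pb_pos in \<open>auto simp: g_def sgn_if less_imp_le\<close>)
    then show "l2_norm ?p ?gv \<le> 1"
      using pb_measure_prob[OF prob] by (simp add: l2_norm_eq[where r = r] prob_on_def)
    show "0 \<le> l2_opnorm ?p \<pi> ?\<Lambda>"
      by (rule l2_norm_mult_le_opnorm[OF pure_birth_link_carrier _ _ wv])
        (use pb_pos \<pi>_pos in \<open>auto simp: less_imp_le\<close>)
  qed
  finally have w_norm: "l2_norm \<pi> wv \<le> exp (- lam 1 * t) * l2_opnorm ?p \<pi> ?\<Lambda>" by simp
  have B_bound: "l2_norm ?p ?uv \<le> l2_opnorm \<pi> ?p B * l2_norm \<pi> wv"
    and nonneg: "0 \<le> l2_opnorm \<pi> ?p B"
    unfolding uv by (rule l2_norm_mult_le_opnorm[OF B(2) _ _ wv];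
        use pb_pos \<pi>_pos in \<open>auto simp: less_imp_le\<close>)+
  note B_bound
  also have "l2_opnorm \<pi> ?p B * l2_norm \<pi> wv
      \<le> l2_opnorm \<pi> ?p B * (exp (- lam 1 * t) * l2_opnorm ?p \<pi> ?\<Lambda>)"
    by (rule mult_left_mono[OF w_norm nonneg])
  also have "\<dots> = condition_number ?p \<pi> ?\<Lambda> * exp (- lam 1 * t)"
    by (simp add: condition_number_def B(1))
  finally have u_norm: "l2_norm ?p ?uv \<le> condition_number ?p \<pi> ?\<Lambda> * exp (- lam 1 * t)" .
  have px: "0 < ?p x" "?p x \<le> 1"
  proof -
    show "0 < ?p x" using pb_pos x .
    have "?p x \<le> (\<Sum>y\<le>r. ?p y)" using pb_pos x by (intro member_le_sum) (auto simp: less_imp_le)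
    then show "?p x \<le> 1" using pb_measure_prob[OF prob] by (simp add: prob_on_def)
  qed
  have "u x \<le> sqrt ((1 - ?p x) / ?p x) * l2_norm ?p ?uv"
    using point_evaluation_bound[of r ?p u x] pb_pos pb_measure_prob[OF prob] mean x
    by (simp add: l2_norm_eq[where r = r] prob_on_def)
  also have "\<dots> \<le> sqrt ((1 - ?p x) / ?p x) * (condition_number ?p \<pi> ?\<Lambda> * exp (- lam 1 * t))"
    using px by (intro mult_left_mono u_norm) simp
  finally show ?thesis unfolding l1 by (simp add: mult_ac)
qed

text \<open>The bound at \<open>x\<close> decreases in \<open>pb_measure r \<pi> x\<close>, so it is worst at the minimum.\<close>

lemma tv_dist_bound:
  assumes lam_0: "lam 0 = 0" and gap: "\<And>j. 1 \<le> j \<Longrightarrow> j \<le> r \<Longrightarrow> lam 1 \<le> lam j" and t: "0 \<le> t"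
  shows "tv_dist r (transition_semigroup L t) (pb_measure r \<pi>)
    \<le> condition_number (pb_measure r \<pi>) \<pi> (pure_birth_link r) * exp (- lam 1 * t) / 2
      * sqrt ((1 - (MIN y\<in>{..r}. pb_measure r \<pi> y)) / (MIN y\<in>{..r}. pb_measure r \<pi> y))"
proof -
  let ?\<Lambda> = "pure_birth_link r" and ?p = "pb_measure r \<pi>"
  let ?\<kappa> = "condition_number ?p \<pi> ?\<Lambda>" and ?m = "MIN y\<in>{..r}. ?p y"
  have "?m \<in> ?p ` {..r}" by (intro Min_in) auto
  then have m: "0 < ?m" using pb_pos by auto
  obtain B where B: "mat_inverse ?\<Lambda> = Some B" "B \<in> carrier_mat (r + 1) (r + 1)"
    by (rule pure_birth_link_inverse)
  have "0 \<le> l2_opnorm ?p \<pi> ?\<Lambda>" "0 \<le> l2_opnorm \<pi> ?p B"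
    using l2_norm_mult_le_opnorm(2)[OF pure_birth_link_carrier, of r ?p \<pi> "0\<^sub>v (r + 1)"]
      l2_norm_mult_le_opnorm(2)[OF B(2), of \<pi> ?p "0\<^sub>v (r + 1)"] pb_pos \<pi>_pos
    by (auto simp: less_imp_le)
  then have \<kappa>: "0 \<le> ?\<kappa>" by (simp add: condition_number_def B(1))
  have "1 / 2 * (\<Sum>y\<le>r. \<bar>transition_semigroup L t $$ (x, y) - ?p y\<bar>)
      \<le> ?\<kappa> * exp (- lam 1 * t) / 2 * sqrt ((1 - ?m) / ?m)" if x: "x \<le> r" for x
  proof -
    have "?m \<le> ?p x" using x by (intro Min_le) auto
    then have "1 / ?p x \<le> 1 / ?m" by (intro frac_le[OF _ order_refl m]) simp_all
    moreover have "(1 - q) / q = 1 / q - 1" if "0 < q" for q :: real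
      using that by (simp add: diff_divide_distrib)
    ultimately have "(1 - ?p x) / ?p x \<le> (1 - ?m) / ?m"
      using m pb_pos[OF x] by (simp only:)
    then have "?\<kappa> * exp (- lam 1 * t) * sqrt ((1 - ?p x) / ?p x)
        \<le> ?\<kappa> * exp (- lam 1 * t) * sqrt ((1 - ?m) / ?m)"
      using \<kappa> by (intro mult_left_mono real_sqrt_le_mono) auto
    then show ?thesis using decay_bound[OF lam_0 gap t x] by simp
  qed
  then show ?thesis unfolding tv_dist_def by (intro Max.boundedI) auto
qed

end

theorem proposition6p1:
  fixes r :: nat
    and b d \<pi>G lam :: "nat \<Rightarrow> real"
    and \<phi> :: "nat \<Rightarrow> real vec"
    and L :: "real mat"
  defines "G \<equiv> birth_death_generator r b d"
    and "\<Lambda> \<equiv> pure_birth_link r"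
    and "P \<equiv> transition_semigroup L"
    and "\<pi>L \<equiv> pb_measure r \<pi>G"
    and "f \<equiv> \<lambda>j. pb_lift r (\<phi> j)"
    and "fs \<equiv> \<lambda>j. pb_dual r \<pi>G (\<phi> j)"
  assumes r: "1 \<le> r"
    and rates: "birth_death_rates r b d"
    and prob: "prob_on r \<pi>G"
    and rev: "reversible r G \<pi>G"
    and eigen: "\<And>j. j \<le> r \<Longrightarrow> eigenvector G (\<phi> j) (- lam j)"
    and orthonormal: "\<And>i j. i \<le> r \<Longrightarrow> j \<le> r \<Longrightarrow> l2_inner \<pi>G (\<phi> i) (\<phi> j) = of_bool (i = j)"
    and lam_0: "lam 0 = 0"
    and lam_mono: "\<And>i j. i \<le> j \<Longrightarrow> j \<le> r \<Longrightarrow> lam i \<le> lam j"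
    and L_dim: "L \<in> carrier_mat (r + 1) (r + 1)"
    and link: "G * \<Lambda> = \<Lambda> * L"
  shows
    "(\<forall>t\<ge>0. \<forall>x\<le>r. \<forall>y\<le>r.
        P t $$ (x, y) = (\<Sum>j\<le>r. exp (- lam j * t) * f j x * fs j y * \<pi>L y))
   \<and> (\<forall>j\<le>r. \<forall>y\<le>r.
        fs j y * \<pi>L y =
          \<phi> j $ (y - 1) * \<pi>G (y - 1) / 2 * of_bool (1 \<le> y)
          + \<phi> j $ y * \<pi>G y * (of_bool (y \<noteq> r) / 2 + of_bool (y = r)))
   \<and> (\<forall>t\<ge>0.
        tv_dist r (P t) \<pi>L \<le>
          condition_number \<pi>L \<pi>G \<Lambda> * exp (- lam 1 * t) / 2
          * sqrt ((1 - (MIN y\<in>{..r}. \<pi>L y)) / (MIN y\<in>{..r}. \<pi>L y)))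
   \<and> (\<forall>x\<le>r.
        L $$ (x, x) =
          - b x - d (min (x + 1) r) * (of_bool (r \<le> x + 1) / 2 + of_bool (x + 1 < r))
        \<and> L $$ (x, x) < 0)
   \<and> (\<forall>x\<le>r. \<forall>y\<le>r. y + 1 < x \<longrightarrow> L $$ (x, y) = 0)
   \<and> (\<forall>x<r.
        L $$ (x + 1, x) = (2 * of_bool (x + 1 \<noteq> r) + of_bool (x + 1 = r)) * (d (x + 1) / 2)
        \<and> 0 < L $$ (x + 1, x))
   \<and> (\<forall>y\<in>{1..r - 1}.
        L $$ (y - 1, y) =
          - d (y - 1) + b y + d (y + 1) * of_bool (y < r - 1) + d (y + 1) / 2 * of_bool (y + 1 = r))
   \<and> L $$ (r - 1, r) = - d (r - 1) + b (r - 1) + d r / 2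
   \<and> (\<forall>y\<in>{2..r - 1}. \<forall>x\<in>{0..y - 2}.
        L $$ (x, y) =
          (- 1) ^ (x + y) * (b (y - 2) + d (y - 1) - b y - d (y + 1) + d r / 2 * of_bool (y = r - 1)))
   \<and> (2 \<le> r \<longrightarrow> (\<forall>x\<in>{0..r - 2}.
        L $$ (x, r) = (- 1) ^ (x + r) * (b (r - 2) + d (r - 1) - b (r - 1) - d r / 2)))
   \<and> (4 \<le> r
      \<and> (\<forall>y\<in>{1..r - 1}.
           0 \<le> - d (y - 1) + b y + d (y + 1) * of_bool (y < r - 1) + d (y + 1) / 2 * of_bool (y + 1 = r))
      \<and> 0 \<le> - d (r - 1) + b (r - 1) + d r
      \<and> (\<forall>y\<in>{2..r - 1}. \<forall>x\<in>{0..y - 2}.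
           0 \<le> (- 1) ^ (x + y) * (b (y - 2) + d (y - 1) - b y - d (y + 1) + d r / 2 * of_bool (y = r - 1)))
      \<and> (\<forall>x\<in>{0..r - 2}.
           0 \<le> (- 1) ^ (x + r) * (b (r - 2) + d (r - 1) - b (r - 1) - d r / 2))
      \<longrightarrow> markov_generator r L)"
proof -
  interpret pure_birth_spectral r b d L \<pi>G lam \<phi>
    using r rates prob rev eigen orthonormal L_dim link unfolding G_def \<Lambda>_def
    by unfold_locales auto
  have f_fs: "fs j y * \<pi>L y = \<phi> j $ (y - 1) * \<pi>G (y - 1) / 2 * of_bool (1 \<le> y)
      + \<phi> j $ y * \<pi>G y * (of_bool (y \<noteq> r) / 2 + of_bool (y = r))" if "y \<le> r" for j y
    unfolding fs_def \<pi>L_def by (rule pb_measure_mult_pb_dual[OF pb_pos[OF that]])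
  have spectral: "P t $$ (x, y) = (\<Sum>j\<le>r. exp (- lam j * t) * f j x * fs j y * \<pi>L y)"
    if "x \<le> r" "y \<le> r" for t x y
    using semigroup_spectral[OF that] by (simp add: P_def f_def fs_def \<pi>L_def mult.assoc)
  have tv: "tv_dist r (P t) \<pi>L \<le> condition_number \<pi>L \<pi>G \<Lambda> * exp (- lam 1 * t) / 2
      * sqrt ((1 - (MIN y\<in>{..r}. \<pi>L y)) / (MIN y\<in>{..r}. \<pi>L y))" if "0 \<le> t" for t
    unfolding P_def \<pi>L_def \<Lambda>_def by (rule tv_dist_bound[OF lam_0 lam_mono that])
  have markov: "markov_generator r L"
    if "4 \<le> r"
      and "\<forall>y\<in>{1..r - 1}.
        0 \<le> - d (y - 1) + b y + d (y + 1) * of_bool (y < r - 1) + d (y + 1) / 2 * of_bool (y + 1 = r)"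
      and "\<forall>y\<in>{2..r - 1}. \<forall>x\<in>{0..y - 2}.
        0 \<le> (- 1) ^ (x + y) * (b (y - 2) + d (y - 1) - b y - d (y + 1) + d r / 2 * of_bool (y = r - 1))"
      and "\<forall>x\<in>{0..r - 2}. 0 \<le> (- 1) ^ (x + r) * (b (r - 2) + d (r - 1) - b (r - 1) - d r / 2)"
  proof (rule markov_generator_if_nonneg)
    show "3 \<le> r" using \<open>4 \<le> r\<close> by simp
    show "0 \<le> L $$ (y - 1, y)" if "y \<in> {1..r - 1}" for y
      unfolding L_superdiag_interior[OF that] using \<open>\<forall>y\<in>{1..r - 1}. _ y\<close> that by (rule bspec)
    show "0 \<le> L $$ (x, y)" if "y \<in> {2..r - 1}" "x \<in> {0..y - 2}" for x y
      unfolding L_above_interior[OF that] using \<open>\<forall>y\<in>{2..r - 1}. _ y\<close> that by (blast dest: bspec)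
    show "0 \<le> L $$ (x, r)" if "x \<in> {0..r - 2}" for x
    proof -
      have "2 \<le> r" using \<open>4 \<le> r\<close> by simp
      then show ?thesis
        unfolding L_above_last[OF \<open>2 \<le> r\<close> that] using \<open>\<forall>x\<in>{0..r - 2}. _ x\<close> that by blast
    qed
  qed
  show ?thesis
    by (intro conjI allI ballI impI; (elim conjE)?)
      (rule spectral f_fs tv L_diag L_diag_neg L_below L_sub L_sub_pos L_superdiag_interior
        L_superdiag_last L_above_interior L_above_last markov; assumption)+
qed

end
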